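(* Suppose that the utility function $U:\mathcal{X}\times\mathcal{Y}\to\mathbb{R}$ is continuous and bounded, that the decision set $\mathcal{A}$ is convex, and that the associated set of laws $\mathcal{A}_d$ is weakly compact, i.e. every sequence in $\mathcal{A}_d$ has a subsequence converging weakly to an element of $\mathcal{A}_d$. Let $\eta\ge 0$. Then the random distributionally robust optimization problem $$J^{c}(\eta)=\sup_{X\in\mathcal{A}}\ \inf_{Y\sim\nu\in D_\eta}\mathbb{E}[U(X,Y)]$$ admits at least one optimal decision $X^*\in\mathcal{A}$, i.e. there is $X^*\in\mathcal{A}$ with $\inf_{Y\sim\nu\in D_\eta}\mathbb{E}[U(X^*,Y)]=J^c(\eta)$.
   Context: $(\Omega,\mathcal{F},\mathbb{P})$ is a complete, non-atomic probability space. $\mathcal{X}\subset\mathbb{R}^n$ and $\mathcal{Y}\subset\mathbb{R}^m$ are closed convex sets. $\mathcal{P}(\cdot)$ denotes the set of Borel probability measures and $\mathcal{M}^+(\cdot)$ the set of finite positive Radon measures. The decision set $\mathcal{A}$ is a set of $\mathcal{X}$-valued random variables on $(\Omega,\mathcal{F},\mathbb{P})$, and $\mathcal{A}_d:=\{\mu\in\mathcal{P}(\mathcal{X}):\mu\text{ is the law of some }X\in\mathcal{A}\}$. An entropy function is a convex lower semicontinuous function $\varphi:[0,\infty)\to[0,\infty]$ such that $\{s\ge0:\varphi(s)<\infty\}\cap(0,\infty)\neq\emptyset$; put $\varphi'_\infty:=\lim_{s\to\infty}\varphi(s)/s$. For $\mu,\nu\in\mathcal{M}^+(\mathcal{Y})$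 with Lebesgue decomposition $\mu=\sigma_\mu\nu+\mu^\perp$ of $\mu$ with respect to $\nu$, the $\varphi$-divergence is $D_\varphi(\mu,\nu)=\int\varphi\circ\sigma_\mu\,d\nu+\varphi'_\infty\,\mu^\perp(\mathcal{Y})$, with $0\cdot\infty=0$. A fixed entropy function $\varphi$ and a benchmark law $\nu_0\in\mathcal{P}(\mathcal{Y})$ are given, and for $\eta\ge0$ the ambiguity set is $D_\eta=\{\nu\in\mathcal{P}(\mathcal{Y}):D_\varphi(\nu,\nu_0)\le\eta\}$. The notation $\inf_{Y\sim\nu\in D_\eta}$ means the infimum over all $\mathcal{Y}$-valued random variables $Y$ on $(\Omega,\mathcal{F},\mathbb{P})$ whose law $\nu$ belongs to $D_\eta$. *)

theory Defs
  imports "HOL-Probability.Probability"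
begin

definition nonatomic_measure :: "'w measure \<Rightarrow> bool" where
  "nonatomic_measure M \<longleftrightarrow>
    (\<forall>A\<in>sets M. 0 < emeasure M A \<longrightarrow>
      (\<exists>B\<in>sets M. B \<subseteq> A \<and> 0 < emeasure M B \<and> emeasure M B < emeasure M A))"

abbreviation borel_on :: "'a::topological_space set \<Rightarrow> 'a measure" where
  "borel_on S \<equiv> restrict_space borel S"

definition borel_probs :: "'a::topological_space set \<Rightarrow> 'a measure set" where
  "borel_probs S = {\<mu>. prob_space \<mu> \<and> sets \<mu> = sets (borel_on S)}"

abbreviation rvs :: "'w measure \<Rightarrow> 'a::topological_space set \<Rightarrow> ('w \<Rightarrow> 'a) set" where
  "rvs M S \<equiv> measurable M (borel_on S)"

abbreviation law :: "'w measure \<Rightarrow> 'a::topological_space set \<Rightarrow> ('w \<Rightarrow> 'a) \<Rightarrow> 'a measure" where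
  "law M S X \<equiv> distr M (borel_on S) X"

definition laws_of :: "'w measure \<Rightarrow> 'a::topological_space set \<Rightarrow> ('w \<Rightarrow> 'a) set \<Rightarrow> 'a measure set"
  where "laws_of M S A = {\<mu> \<in> borel_probs S. \<exists>X\<in>A. \<mu> = law M S X}"

text \<open>Random variables are functions on \<open>space M\<close>; their values outside \<open>space M\<close> carry no
  meaning, so the convex combination is only compared on \<open>space M\<close>.\<close>

definition convex_rvs :: "'w measure \<Rightarrow> ('w \<Rightarrow> 'a::real_vector) set \<Rightarrow> bool" where
  "convex_rvs M A \<longleftrightarrow>
    (\<forall>X\<in>A. \<forall>Z\<in>A. \<forall>u\<in>{0..1}. \<exists>W\<in>A. \<forall>\<omega>\<in>space M. W \<omega> = (1 - u) *\<^sub>R X \<omega> + u *\<^sub>R Z \<omega>)"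

definition weakly_converges ::
    "'a::topological_space set \<Rightarrow> (nat \<Rightarrow> 'a measure) \<Rightarrow> 'a measure \<Rightarrow> bool" where
  "weakly_converges S \<mu>s \<mu> \<longleftrightarrow>
    (\<forall>f :: 'a \<Rightarrow> real. continuous_on S f \<and> bounded (f ` S) \<longrightarrow>
      (\<lambda>k. \<integral>x. f x \<partial>\<mu>s k) \<longlonglongrightarrow> (\<integral>x. f x \<partial>\<mu>))"

definition weakly_compact :: "'a::topological_space set \<Rightarrow> 'a measure set \<Rightarrow> bool" where
  "weakly_compact S L \<longleftrightarrow>
    (\<forall>\<mu>s :: nat \<Rightarrow> 'a measure. (\<forall>k. \<mu>s k \<in> L) \<longrightarrow>
      (\<exists>\<mu>\<in>L. \<exists>r. strict_mono r \<and> weakly_converges S (\<mu>s \<circ> r) \<mu>))"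

text \<open>An entropy function lives on \<open>{0..}\<close>; its values at negative arguments are never used.\<close>

definition entropy_function :: "(real \<Rightarrow> ennreal) \<Rightarrow> bool" where
  "entropy_function \<phi> \<longleftrightarrow>
    (\<forall>s\<ge>0. \<forall>t\<ge>0. \<forall>u\<in>{0..1}.
      \<phi> ((1 - u) * s + u * t) \<le> ennreal (1 - u) * \<phi> s + ennreal u * \<phi> t) \<and>
    (\<forall>s\<ge>0. \<phi> s \<le> Liminf (at s within {0..}) \<phi>) \<and>
    (\<exists>s>0. \<phi> s < \<infinity>)"

definition recession_slope :: "(real \<Rightarrow> ennreal) \<Rightarrow> ennreal" where
  "recession_slope \<phi> = Lim at_top (\<lambda>s. \<phi> s / ennreal s)"

definition lebesgue_decomp ::
    "'a measure \<Rightarrow> 'a measure \<Rightarrow> ('a \<Rightarrow> real) \<Rightarrow> 'a measure \<Rightarrow> bool" where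
  "lebesgue_decomp \<mu> \<nu> \<sigma> \<mu>s \<longleftrightarrow>
    sets \<mu> = sets \<nu> \<and> sets \<mu>s = sets \<nu> \<and>
    \<sigma> \<in> borel_measurable \<nu> \<and> (\<forall>x. 0 \<le> \<sigma> x) \<and>
    (\<forall>A\<in>sets \<nu>. emeasure \<mu> A = (\<integral>\<^sup>+x\<in>A. ennreal (\<sigma> x) \<partial>\<nu>) + emeasure \<mu>s A) \<and>
    (\<exists>N\<in>null_sets \<nu>. emeasure \<mu>s (space \<nu> - N) = 0)"

definition phi_divergence :: "(real \<Rightarrow> ennreal) \<Rightarrow> 'a measure \<Rightarrow> 'a measure \<Rightarrow> ennreal" where
  "phi_divergence \<phi> \<mu> \<nu> =
    (THE d. \<exists>\<sigma> \<mu>s. lebesgue_decomp \<mu> \<nu> \<sigma> \<mu>s \<and>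
      d = (\<integral>\<^sup>+x. \<phi> (\<sigma> x) \<partial>\<nu>) + recession_slope \<phi> * emeasure \<mu>s (space \<mu>s))"

text \<open>The description in \<open>phi_divergence\<close> is proper on finite measures.\<close>

lemma lebesgue_decomp_exists:
  assumes "finite_measure \<mu>" "finite_measure \<nu>" and s: "sets \<mu> = sets \<nu>"
  shows "\<exists>\<sigma> \<mu>s. lebesgue_decomp \<mu> \<nu> \<sigma> \<mu>s"
proof -
  interpret m: finite_measure \<mu> by fact
  interpret n: finite_measure \<nu> by fact
  have sp: "space \<mu> = space \<nu>" using s by (rule sets_eq_imp_space_eq)
  define c where "c = (SUP N\<in>null_sets \<nu>. emeasure \<mu> N)"
  have "emeasure \<mu> ` null_sets \<nu> \<noteq> {}" by blast
  from ennreal_Sup_countable_SUP[OF this]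
  have "\<exists>f::nat \<Rightarrow> ennreal. range f \<subseteq> emeasure \<mu> ` null_sets \<nu> \<and> c = (SUP i. f i)"
    unfolding c_def by blast
  then obtain f :: "nat \<Rightarrow> ennreal" where f: "range f \<subseteq> emeasure \<mu> ` null_sets \<nu>" "c = (SUP i. f i)"
    by blast
  then have "\<forall>i. \<exists>K. K \<in> null_sets \<nu> \<and> f i = emeasure \<mu> K" by blast
  then obtain K where K: "\<And>i. K i \<in> null_sets \<nu>" "\<And>i. f i = emeasure \<mu> (K i)" by metis
  define N where "N = (\<Union>i. K i)"
  have N: "N \<in> null_sets \<nu>" unfolding N_def using K(1) by blast
  then have Ns: "N \<in> sets \<mu>" "N \<in> sets \<nu>" using s by auto
  have "c \<le> emeasure \<mu> N"
    unfolding f(2) K(2) using Ns by (intro SUP_least emeasure_mono) (auto simp: N_def)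
  then have Nmax: "emeasure \<mu> B \<le> emeasure \<mu> N" if "B \<in> null_sets \<nu>" for B
    using that unfolding c_def by (meson SUP_upper order_trans)
  define a where "a = density \<mu> (indicator (space \<nu> - N))"
  define \<mu>s where "\<mu>s = density \<mu> (indicator N)"
  have a: "emeasure a A = emeasure \<mu> (A - N)" if "A \<in> sets \<nu>" for A
  proof -
    have "(space \<nu> - N) \<inter> A = A - N" using sets.sets_into_space[OF that] by auto
    then show ?thesis using that Ns s sp
      by (simp add: a_def emeasure_density nn_integral_set_ennreal nn_integral_indicator
            indicator_inter_arith[symmetric] Int_commute del: sets.Diff)
  qed
  have ms: "emeasure \<mu>s A = emeasure \<mu> (A \<inter> N)" if "A \<in> sets \<nu>" for A
    using that Ns s by (simp add: \<mu>s_def emeasure_density indicator_inter_arith[symmetric] Int_commute)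
  have ac: "absolutely_continuous \<nu> a"
    unfolding absolutely_continuous_def
  proof
    fix B assume B: "B \<in> null_sets \<nu>"
    then have Bs: "B \<in> sets \<nu>" by auto
    have "emeasure \<mu> N + emeasure \<mu> (B - N) = emeasure \<mu> (N \<union> B)"
      using Bs Ns s by (subst plus_emeasure) (auto simp: Un_commute)
    also have "\<dots> \<le> emeasure \<mu> N + 0" using Nmax[of "N \<union> B"] B N by (simp add: null_sets.Un)
    finally have "emeasure \<mu> (B - N) \<le> 0"
      using m.emeasure_finite[of N] by (metis ennreal_add_left_cancel_le infinity_ennreal_def)
    then show "B \<in> null_sets a" using a[OF Bs] Bs s by (auto simp: null_sets_def a_def)
  qed
  have sa: "sets a = sets \<nu>" using s by (simp add: a_def)
  have fa: "finite_measure a"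
    using a[of "space \<nu>"] m.emeasure_finite sets_eq_imp_space_eq[OF sa] by (intro finite_measureI) auto
  interpret aa: finite_measure a by fact
  obtain g where g: "g \<in> borel_measurable \<nu>" "density \<nu> g = a"
    using n.Radon_Nikodym[OF ac sa] by blast
  have "AE x in \<nu>. g x \<noteq> \<infinity>"
  proof (rule nn_integral_PInf_AE[OF g(1)])
    have "(\<integral>\<^sup>+x. g x \<partial>\<nu>) = emeasure (density \<nu> g) (space \<nu>)"
      using g(1) by (simp add: emeasure_density nn_integral_set_ennreal cong: nn_integral_cong)
    then show "(\<integral>\<^sup>+x. g x \<partial>\<nu>) \<noteq> \<infinity>" using aa.emeasure_finite g(2) by simp
  qed
  then have ge: "AE x in \<nu>. ennreal (enn2real (g x)) = g x"
    by eventually_elim (simp add: top.not_eq_extremum)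
  have "lebesgue_decomp \<mu> \<nu> (\<lambda>x. enn2real (g x)) \<mu>s"
    unfolding lebesgue_decomp_def
  proof (intro conjI ballI allI bexI[of _ N])
    fix A assume A: "A \<in> sets \<nu>"
    have "(\<integral>\<^sup>+x\<in>A. ennreal (enn2real (g x)) \<partial>\<nu>) = (\<integral>\<^sup>+x\<in>A. g x \<partial>\<nu>)"
      using ge by (intro nn_integral_cong_AE) auto
    also have "\<dots> = emeasure \<mu> (A - N)" using A g a[OF A] by (metis emeasure_density)
    moreover have "emeasure \<mu> A = emeasure \<mu> (A - N) + emeasure \<mu> (A \<inter> N)"
      using A Ns s by (subst plus_emeasure) (auto simp: Un_Diff_Int Int_commute intro!: arg_cong[where f = "emeasure \<mu>"])
    ultimately show "emeasure \<mu> A = (\<integral>\<^sup>+x\<in>A. ennreal (enn2real (g x)) \<partial>\<nu>) + emeasure \<mu>s A"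
      using ms[OF A] by simp
  next
    show "emeasure \<mu>s (space \<nu> - N) = 0" using ms[of "space \<nu> - N"] Ns by (simp add: Diff_Int_distrib2 Int_absorb1 Int_commute Diff_disjoint)
  qed (use g s N in \<open>auto simp: \<mu>s_def\<close>)
  then show ?thesis by blast
qed

lemma phi_divergence_eq:
  assumes fin: "finite_measure \<mu>" "finite_measure \<nu>" and L: "lebesgue_decomp \<mu> \<nu> \<sigma> \<mu>s"
  shows "phi_divergence \<phi> \<mu> \<nu> = (\<integral>\<^sup>+x. \<phi> (\<sigma> x) \<partial>\<nu>) + recession_slope \<phi> * emeasure \<mu>s (space \<mu>s)"
  unfolding phi_divergence_def
proof (rule the_equality)
  fix d assume "\<exists>\<sigma> \<mu>s. lebesgue_decomp \<mu> \<nu> \<sigma> \<mu>s \<and>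
      d = (\<integral>\<^sup>+x. \<phi> (\<sigma> x) \<partial>\<nu>) + recession_slope \<phi> * emeasure \<mu>s (space \<mu>s)"
  then obtain \<sigma>' \<mu>s' where L': "lebesgue_decomp \<mu> \<nu> \<sigma>' \<mu>s'"
    and d: "d = (\<integral>\<^sup>+x. \<phi> (\<sigma>' x) \<partial>\<nu>) + recession_slope \<phi> * emeasure \<mu>s' (space \<mu>s')" by blast
  interpret m: finite_measure \<mu> by fact
  interpret n: finite_measure \<nu> by fact
  obtain N where N: "N \<in> null_sets \<nu>" "emeasure \<mu>s (space \<nu> - N) = 0"
    using L unfolding lebesgue_decomp_def by blast
  obtain N' where N': "N' \<in> null_sets \<nu>" "emeasure \<mu>s' (space \<nu> - N') = 0"
    using L' unfolding lebesgue_decomp_def by blast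
  define P where "P = N \<union> N'"
  have P: "P \<in> null_sets \<nu>" using N N' by (auto simp: P_def)
  then have Ps: "P \<in> sets \<nu>" by auto
  have key: "(\<integral>\<^sup>+x\<in>A. ennreal (\<tau> x) \<partial>\<nu>) = emeasure \<mu> (A - P)" "emeasure m A = emeasure \<mu> (A \<inter> P)"
    if D: "lebesgue_decomp \<mu> \<nu> \<tau> m" and Q: "Q \<in> null_sets \<nu>" "emeasure m (space \<nu> - Q) = 0" "Q \<subseteq> P"
      and A: "A \<in> sets \<nu>" for \<tau> m Q A
  proof -
    have D': "sets m = sets \<nu>" "\<And>B. B \<in> sets \<nu> \<Longrightarrow>
        emeasure \<mu> B = (\<integral>\<^sup>+x\<in>B. ennreal (\<tau> x) \<partial>\<nu>) + emeasure m B"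
      using D unfolding lebesgue_decomp_def by auto
    have z: "emeasure m (A - P) = 0"
    proof -
      have "emeasure m (A - P) \<le> emeasure m (space \<nu> - Q)"
        using Q A sets.sets_into_space[OF A] D'(1) by (intro emeasure_mono) auto
      then show ?thesis using Q by simp
    qed
    have i: "AE x in \<nu>. x \<notin> P" using P by (rule AE_not_in)
    have "(\<integral>\<^sup>+x\<in>A. ennreal (\<tau> x) \<partial>\<nu>) = (\<integral>\<^sup>+x\<in>A - P. ennreal (\<tau> x) \<partial>\<nu>)"
      using i by (intro nn_integral_cong_AE) (auto simp: indicator_def)
    then show "(\<integral>\<^sup>+x\<in>A. ennreal (\<tau> x) \<partial>\<nu>) = emeasure \<mu> (A - P)"
      using D'(2)[of "A - P"] A Ps z by auto
    have "(\<integral>\<^sup>+x\<in>A \<inter> P. ennreal (\<tau> x) \<partial>\<nu>) = (\<integral>\<^sup>+x. 0 \<partial>\<nu>)"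
      using i by (intro nn_integral_cong_AE) (auto simp: indicator_def)
    then have "emeasure \<mu> (A \<inter> P) = emeasure m (A \<inter> P)"
      using D'(2)[of "A \<inter> P"] A Ps by auto
    moreover have "emeasure m A = emeasure m (A \<inter> P) + emeasure m (A - P)"
      using A Ps D'(1) by (subst plus_emeasure) (auto simp: Un_Diff_Int Int_Diff_Un)
    ultimately show "emeasure m A = emeasure \<mu> (A \<inter> P)" using z by simp
  qed
  have meas: "(\<lambda>x. ennreal (\<sigma> x)) \<in> borel_measurable \<nu>" "(\<lambda>x. ennreal (\<sigma>' x)) \<in> borel_measurable \<nu>"
    using L L' unfolding lebesgue_decomp_def by auto
  have "density \<nu> (\<lambda>x. ennreal (\<sigma>' x)) = density \<nu> (\<lambda>x. ennreal (\<sigma> x))"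
    using key(1)[OF L N] key(1)[OF L' N'] meas
    by (intro measure_eqI) (auto simp: emeasure_density P_def)
  then have "AE x in \<nu>. ennreal (\<sigma>' x) = ennreal (\<sigma> x)"
    using meas by (subst n.density_unique_iff[symmetric]) auto
  then have "AE x in \<nu>. \<sigma>' x = \<sigma> x"
    using L L' unfolding lebesgue_decomp_def by auto
  then have 1: "(\<integral>\<^sup>+x. \<phi> (\<sigma>' x) \<partial>\<nu>) = (\<integral>\<^sup>+x. \<phi> (\<sigma> x) \<partial>\<nu>)"
    by (intro nn_integral_cong_AE) auto
  have sp: "space \<mu>s = space \<nu>" "space \<mu>s' = space \<nu>"
    using L L' sets_eq_imp_space_eq unfolding lebesgue_decomp_def by metis+
  have "emeasure \<mu>s' (space \<mu>s') = emeasure \<mu>s (space \<mu>s)"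
    using key(2)[OF L N, of "space \<nu>"] key(2)[OF L' N', of "space \<nu>"] sp by (auto simp: P_def)
  then show "d = (\<integral>\<^sup>+x. \<phi> (\<sigma> x) \<partial>\<nu>) + recession_slope \<phi> * emeasure \<mu>s (space \<mu>s)"
    using d 1 by simp
qed (use L in blast)

definition ambiguity_set ::
    "(real \<Rightarrow> ennreal) \<Rightarrow> 'b::topological_space set \<Rightarrow> 'b measure \<Rightarrow> real \<Rightarrow> 'b measure set" where
  "ambiguity_set \<phi> T \<nu>0 \<eta> = {\<nu> \<in> borel_probs T. phi_divergence \<phi> \<nu> \<nu>0 \<le> ennreal \<eta>}"

text \<open>Values are taken in \<^typ>\<open>ereal\<close>, so that the infimum over an empty ambiguity set is \<open>\<infinity>\<close>.\<close>

definition worst_case_utility ::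
    "'w measure \<Rightarrow> 'b::topological_space set \<Rightarrow> ('a \<times> 'b \<Rightarrow> real) \<Rightarrow> 'b measure set \<Rightarrow> ('w \<Rightarrow> 'a) \<Rightarrow> ereal"
  where
  "worst_case_utility M T U D X =
    (INF Y\<in>{Y \<in> rvs M T. law M T Y \<in> D}. ereal (\<integral>\<omega>. U (X \<omega>, Y \<omega>) \<partial>M))"

definition robust_value ::
    "'w measure \<Rightarrow> 'b::topological_space set \<Rightarrow> ('a \<times> 'b \<Rightarrow> real) \<Rightarrow> 'b measure set \<Rightarrow> ('w \<Rightarrow> 'a) set \<Rightarrow> ereal"
  where
  "robust_value M T U D A = (SUP X\<in>A. worst_case_utility M T U D X)"

end

theory Submission
  imports Defs
begin

text \<open>Only the laws of the decisions matter. Let \<open>X\<^sub>k\<close> converge in law to \<open>X\<close>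
  and let \<open>Y\<close> be arbitrary. Up to small mass the law of \<open>X\<close> is carried by finitely many
  disjoint compact cells \<open>K\<^sub>i\<close> of small diameter, with disjoint open neighbourhoods \<open>G\<^sub>i\<close>, and for
  large \<open>k\<close> the event \<open>X\<^sub>k \<in> G\<^sub>i\<close> is almost as likely as \<open>X \<in> K\<^sub>i\<close>. Since the space is
  non-atomic, one can build on most of \<open>X\<^sub>k \<in> G\<^sub>i\<close> a variable with the law that \<open>Y\<close> has on
  \<open>X \<in> K\<^sub>i\<close>, and on the remaining event a variable with the remaining part of the law of \<open>Y\<close>. The
  resulting \<open>Y\<^sub>k\<close> has exactly the law of \<open>Y\<close>, so it is feasible for the same ambiguity set, and
  \<open>E U(X\<^sub>k, Y\<^sub>k)\<close> is close to \<open>E U(X, Y)\<close>. Hence the worst-case utility is upper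
  semicontinuous under convergence in law, and a maximising sequence has a maximiser as its limit.\<close>


section \<open>Intermediate values of non-atomic measures\<close>

text \<open>Needed to realise a prescribed law separately on each event of a partition.\<close>

lemma nonatomic_measure_restrict:
  assumes "nonatomic_measure M" "E \<in> sets M"
  shows "nonatomic_measure (restrict_space M E)"
  unfolding nonatomic_measure_def
proof (intro ballI impI)
  fix A assume A: "A \<in> sets (restrict_space M E)" "0 < emeasure (restrict_space M E) A"
  have AM: "A \<in> sets M" "A \<subseteq> E"
    using A(1) assms(2) by (auto simp: sets_restrict_space)
  have eq: "emeasure (restrict_space M E) B = emeasure M B" if "B \<subseteq> E" for B
    using assms(2) that by (intro emeasure_restrict_space) auto
  obtain B where B: "B \<in> sets M" "B \<subseteq> A" "0 < emeasure M B" "emeasure M B < emeasure M A"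
    using assms(1) A(2) AM eq[OF AM(2)] unfolding nonatomic_measure_def by metis
  moreover have "B \<in> sets (restrict_space M E)"
    using B AM assms(2) by (auto simp: sets_restrict_space_iff)
  ultimately show "\<exists>B\<in>sets (restrict_space M E). B \<subseteq> A \<and> 0 < emeasure (restrict_space M E) B \<and>
      emeasure (restrict_space M E) B < emeasure (restrict_space M E) A"
    using eq AM by (metis order_trans)
qed

context finite_measure begin

text \<open>Halving: a set \<open>B\<close> of positive measure contains some \<open>C\<close> of
  strictly smaller positive measure, and one of \<open>C\<close> and \<open>B - C\<close> has at
  most half the measure of \<open>B\<close>. Iteration pushes the measure below
  \<open>e\<close>.\<close>

lemma nonatomic_small_subset:
  assumes "nonatomic_measure M" "A \<in> sets M" "0 < measure M A" "0 < e"
  obtains B where "B \<in> sets M" "B \<subseteq> A" "0 < measure M B" "measure M B < e"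
proof -
  have half: "\<exists>B\<in>sets M. B \<subseteq> A \<and> 0 < measure M B \<and> measure M B \<le> measure M A / 2 ^ n" for n
  proof (induction n)
    case (Suc n)
    then obtain B where B: "B \<in> sets M" "B \<subseteq> A" "0 < measure M B" "measure M B \<le> measure M A / 2 ^ n"
      by blast
    then obtain C where C: "C \<in> sets M" "C \<subseteq> B" "0 < emeasure M C" "emeasure M C < emeasure M B"
      using assms(1) unfolding nonatomic_measure_def by (metis emeasure_eq_measure ennreal_less_zero_iff)
    then have m: "0 < measure M C" "measure M C < measure M B"
      by (auto simp: emeasure_eq_measure ennreal_less_iff)
    have D: "measure M (B - C) = measure M B - measure M C"
      using B C by (simp add: finite_measure_Diff)
    show ?case
    proof (cases "measure M C \<le> measure M B / 2")
      case True
      then show ?thesis using B C m by (intro bexI[of _ C]) auto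
    next
      case False
      then show ?thesis using B C m D by (intro bexI[of _ "B - C"]) auto
    qed
  qed (use assms in auto)
  obtain n where "measure M A / e < 2 ^ n" using real_arch_pow[of 2 "measure M A / e"] by auto
  then have "measure M A / 2 ^ n < e" using assms(4) by (simp add: field_simps)
  then show thesis using half[of n] that by force
qed

text \<open>Sierpinski's theorem. Each step of the greedy construction gains at least half of what can
  still be gained below \<open>t\<close>.\<close>

lemma nonatomic_intermediate_value:
  assumes na: "nonatomic_measure M" and L: "L \<in> sets M" and H: "H \<in> sets M" and "L \<subseteq> H"
    and t: "measure M L \<le> t" "t \<le> measure M H"
  obtains S where "S \<in> sets M" "L \<subseteq> S" "S \<subseteq> H" "measure M S = t"
proof -
  define good where "good = {S \<in> sets M. L \<subseteq> S \<and> S \<subseteq> H \<and> measure M S \<le> t}"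
  define gain where "gain S S' \<longleftrightarrow>
    S \<subseteq> S' \<and> (\<forall>T\<in>good. S \<subseteq> T \<longrightarrow> measure M T - measure M S' \<le> measure M S' - measure M S)" for S S'
  have step: "\<exists>S'\<in>good. gain S S'" if S: "S \<in> good" for S
  proof -
    define V where "V = measure M ` {T \<in> good. S \<subseteq> T}"
    have V: "V \<noteq> {}" "bdd_above V" using S by (auto simp: V_def good_def intro!: bdd_aboveI[of _ t])
    then have le: "measure M T \<le> Sup V" if "T \<in> good" "S \<subseteq> T" for T
      using that by (auto simp: V_def intro!: cSup_upper)
    have "measure M S \<le> Sup V" using le S by auto
    show ?thesis
    proof (cases "measure M S = Sup V")
      case True
      then show ?thesis using S le by (intro bexI[of _ S]) (auto simp: gain_def)
    next
      case False
      then have "(measure M S + Sup V) / 2 < Sup V" using \<open>measure M S \<le> Sup V\<close> by simp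
      then obtain v where v: "v \<in> V" "(measure M S + Sup V) / 2 < v" using less_cSupE[OF _ V(1)] by blast
      then obtain S' where S': "S' \<in> good" "S \<subseteq> S'" "v = measure M S'" by (auto simp: V_def)
      have "measure M T - measure M S' \<le> measure M S' - measure M S" if "T \<in> good" "S \<subseteq> T" for T
        using le[OF that] v(2) S'(3) by (simp add: field_simps)
      then show ?thesis using S' by (intro bexI[of _ S']) (auto simp: gain_def)
    qed
  qed
  have "\<exists>f. \<forall>n. f n \<in> good \<and> gain (f n) (f (Suc n))"
  proof (rule dependent_nat_choice)
    show "\<exists>x. x \<in> good" using assms by (auto simp: good_def)
  qed (use step in blast)
  then obtain f where f: "\<And>n. f n \<in> good" "\<And>n. gain (f n) (f (Suc n))" by blast
  have inc: "incseq f" using f(2) by (auto simp: incseq_Suc_iff gain_def)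
  define S where "S = (\<Union>n. f n)"
  have lim: "(\<lambda>n. measure M (f n)) \<longlonglongrightarrow> measure M S"
    unfolding S_def using f(1) inc by (intro finite_Lim_measure_incseq) (auto simp: good_def)
  then have "measure M S \<le> t"
    using f(1) by (intro LIMSEQ_le_const2[OF lim]) (auto simp: good_def)
  moreover have S: "S \<in> sets M" "L \<subseteq> S" "S \<subseteq> H" using f(1) by (auto simp: good_def S_def)
  moreover have "\<not> measure M S < t"
  proof
    assume less: "measure M S < t"
    then have "0 < measure M (H - S)" using S H t by (simp add: finite_measure_Diff)
    moreover have "0 < t - measure M S" using less by simp
    ultimately obtain B where B: "B \<in> sets M" "B \<subseteq> H - S" "0 < measure M B" "measure M B < t - measure M S"
      using nonatomic_small_subset[OF na, of "H - S"] S H by blast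
    have SB: "measure M (S \<union> B) = measure M S + measure M B"
      using S B by (intro finite_measure_Union) auto
    then have "S \<union> B \<in> good" using S B by (auto simp: good_def)
    \<comment> \<open>\<open>S \<union> B\<close> competes at every step, so each increment of
      \<open>measure M (f n)\<close> is at least what \<open>S \<union> B\<close> still gains over
      \<open>f (Suc n)\<close>. The increments tend to 0, whereas this gain tends to
      \<open>measure M B\<close>, which is positive.\<close>
    have "measure M (S \<union> B) - measure M (f (Suc n)) \<le> measure M (f (Suc n)) - measure M (f n)" for n
    proof -
      have "f n \<subseteq> S \<union> B" by (auto simp: S_def)
      then show ?thesis using f(2)[of n] \<open>S \<union> B \<in> good\<close> unfolding gain_def by blast
    qed
    then have "measure M (S \<union> B) - measure M S \<le> measure M S - measure M S"
      using LIMSEQ_Suc[OF lim] lim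
      by (intro LIMSEQ_le[of "\<lambda>n. measure M (S \<union> B) - measure M (f (Suc n))" _ "\<lambda>n. measure M (f (Suc n)) - measure M (f n)"] tendsto_intros) auto
    then show False using SB B by simp
  qed
  ultimately show thesis using that by force
qed

end


section \<open>Realising a prescribed law\<close>

context finite_measure begin

text \<open>Indices are treated in the order of their codes \<open>to_nat\<close>. The set of a new
  index is inserted, by the intermediate value property, between the sets of its nearest neighbours
  among the finitely many indices already treated; earlier sets are never changed.\<close>

lemma nonatomic_chain:
  fixes g :: "'i::{countable,linorder} \<Rightarrow> real"
  assumes na: "nonatomic_measure M" and g: "mono g" "\<And>i. 0 \<le> g i" "\<And>i. g i \<le> measure M (space M)"
  obtains F where "\<And>i. F i \<in> sets M" "\<And>i. measure M (F i) = g i" "mono F"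
proof -
  define P where "P n x \<longleftrightarrow> (\<forall>i. to_nat i < n \<longrightarrow> x i \<in> sets M \<and> measure M (x i) = g i) \<and>
    (\<forall>i j. to_nat i < n \<longrightarrow> to_nat j < n \<longrightarrow> i \<le> j \<longrightarrow> x i \<subseteq> x j)" for n and x :: "'i \<Rightarrow> 'a set"
  have "\<exists>f. \<forall>n. P n (f n) \<and> (\<forall>i. to_nat i < n \<longrightarrow> f (Suc n) i = f n i)"
  proof (rule dependent_nat_choice)
    fix x n assume x: "P n x"
    show "\<exists>y. P (Suc n) y \<and> (\<forall>i. to_nat i < n \<longrightarrow> y i = x i)"
    proof (cases "\<exists>k::'i. to_nat k = n")
      \<comment> \<open>\<open>to_nat\<close> is injective but need not be onto, so there may be no
        index with code \<open>n\<close>; this stage then keeps the family as it is.\<close>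
      case False
      then have "P (Suc n) x" using x unfolding P_def by (metis less_Suc_eq)
      then show ?thesis by blast
    next
      case True
      then obtain k :: 'i where k: "to_nat k = n" by blast
      define I where "I = {i. to_nat i < n \<and> i \<le> k}"
      define J where "J = {i. to_nat i < n \<and> k \<le> i}"
      \<comment> \<open>A missing neighbour is replaced by the empty set or by the whole space; the
        bounds on \<open>g\<close> make both admissible.\<close>
      define L where "L = (if I = {} then {} else x (Max I))"
      define H where "H = (if J = {} then space M else x (Min J))"
      have "finite {i::'i. to_nat i < n}"
        by (rule finite_imageD[of to_nat]) (auto intro: finite_subset[of _ "{..<n}"] inj_on_subset[OF inj_to_nat])
      then have fin: "finite I" "finite J" unfolding I_def J_def by (auto elim: rev_finite_subset)
      have Max: "Max I \<in> I" if "I \<noteq> {}" using fin that by simp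
      have Min: "Min J \<in> J" if "J \<noteq> {}" using fin that by simp
      have LH: "L \<in> sets M" "H \<in> sets M" "measure M L \<le> g k" "g k \<le> measure M H"
        using x Max Min g monoD[OF g(1)] unfolding P_def L_def H_def I_def J_def by auto
      have "L \<subseteq> H"
      proof (cases "I = {} \<or> J = {}")
        case True
        then show ?thesis
          using sets.sets_into_space[OF LH(1)] by (cases "I = {}") (simp_all add: L_def H_def)
      next
        case False
        then have "Max I \<le> Min J" using Max Min unfolding I_def J_def by (metis (no_types, lifting) mem_Collect_eq order_trans)
        then show ?thesis using x Max Min False unfolding P_def L_def H_def I_def J_def by auto
      qed
      then obtain S where S: "S \<in> sets M" "L \<subseteq> S" "S \<subseteq> H" "measure M S = g k"
        using nonatomic_intermediate_value[OF na] LH by metis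
      have lower: "x i \<subseteq> S" if "to_nat i < n" "i \<le> k" for i
      proof -
        have i: "i \<in> I" using that by (simp add: I_def)
        then have "i \<le> Max I" "Max I \<in> I" using Max_ge[OF fin(1) i] Max by blast+
        then have "x i \<subseteq> x (Max I)" using x that unfolding P_def I_def by auto
        moreover have "L = x (Max I)" using i by (auto simp: L_def)
        ultimately show ?thesis using S(2) by simp
      qed
      have upper: "S \<subseteq> x i" if "to_nat i < n" "k \<le> i" for i
      proof -
        have i: "i \<in> J" using that by (simp add: J_def)
        then have "Min J \<le> i" "Min J \<in> J" using Min_le[OF fin(2) i] Min by blast+
        then have "x (Min J) \<subseteq> x i" using x that unfolding P_def J_def by auto
        moreover have "H = x (Min J)" using i by (auto simp: H_def)
        ultimately show ?thesis using S(3) by simp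
      qed
      have k': "to_nat i < Suc n \<longleftrightarrow> i = k \<or> to_nat i < n" for i
        using k by (metis less_Suc_eq from_nat_to_nat)
      have "P (Suc n) (x(k := S))"
        using x S lower upper k unfolding P_def k' by auto
      then show ?thesis using k by (intro exI[of _ "x(k := S)"]) auto
    qed
  qed (simp add: P_def)
  then obtain f where f: "\<And>n. P n (f n)" "\<And>n i. to_nat i < n \<Longrightarrow> f (Suc n) i = f n i" by blast
  \<comment> \<open>Stage \<open>Suc (to_nat i)\<close> is the first that settles index
    \<open>i\<close>, and all later stages keep its value.\<close>
  define F where "F i = f (Suc (to_nat i)) i" for i
  have F: "f n i = F i" if "to_nat i < n" for i n
    using that
  proof (induction n)
    case (Suc n)
    then show ?case using f(2)[of i n] by (cases "to_nat i = n") (auto simp: F_def)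
  qed simp
  show thesis
  proof
    fix i
    show "F i \<in> sets M" "measure M (F i) = g i"
      using f(1)[of "Suc (to_nat i)"] unfolding P_def F_def by auto
  next
    show "mono F"
    proof (rule monoI)
      fix i j :: 'i assume "i \<le> j"
      define n where "n = Suc (max (to_nat i) (to_nat j))"
      have "to_nat i < n" "to_nat j < n" by (auto simp: n_def)
      moreover have "f n i \<subseteq> f n j"
        using f(1)[of n] \<open>i \<le> j\<close> calculation unfolding P_def by blast
      ultimately show "F i \<subseteq> F j" using F by simp
    qed
  qed
qed

end

section \<open>Variables with a prescribed law on the unit interval\<close>

lemma rat_decseq_above:
  fixes t :: real
  obtains r :: "nat \<Rightarrow> rat" where "decseq r" "\<And>n. t < of_rat (r n)" "\<And>n. of_rat (r n) < t + 1 / Suc n"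
proof -
  have "\<exists>r. \<forall>n. (t < of_rat (r n) \<and> of_rat (r n) < t + 1 / Suc n) \<and> r (Suc n) \<le> (r n :: rat)"
  proof (rule dependent_nat_choice)
    show "\<exists>x. t < of_rat x \<and> of_rat x < t + 1 / Suc 0" using of_rat_dense[of t "t + 1"] by auto
  next
    fix x n assume "t < of_rat x \<and> of_rat x < t + 1 / Suc n"
    then have "t < min (of_rat x) (t + 1 / Suc (Suc n))" by auto
    from of_rat_dense[OF this]
    show "\<exists>y. (t < of_rat y \<and> of_rat y < t + 1 / Suc (Suc n)) \<and> y \<le> x" 
      by (metis less_eq_real_def min_less_iff_conj of_rat_less_eq)
  qed
  then show thesis using that by (metis decseq_SucI)
qed

text \<open>Every rational above \<open>t\<close> lies above some \<open>r n\<close>, so an antitone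
  family has the same union along \<open>r\<close>. When \<open>r\<close> decreases, this is an
  increasing sequence, to which continuity from below applies.\<close>

lemma UN_rat_above_eq:
  fixes G :: "rat \<Rightarrow> 'a set" and t :: real
  assumes "antimono G" and r: "\<And>n. t < of_rat (r n)" "\<And>n. of_rat (r n) < t + 1 / Suc n"
  shows "(\<Union>q\<in>{q. t < of_rat q}. G q) = (\<Union>n::nat. G (r n))"
proof (intro antisym subsetI)
  fix x assume "x \<in> (\<Union>q\<in>{q. t < of_rat q}. G q)"
  then obtain q where q: "t < of_rat q" "x \<in> G q" by blast
  then obtain n where "inverse (real (Suc n)) < of_rat q - t" using reals_Archimedean[of "of_rat q - t"] by auto
  then have "of_rat (r n) < (of_rat q :: real)" using r(2)[of n] by (simp add: divide_inverse)
  then have "r n \<le> q" by (simp add: of_rat_less)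
  then show "x \<in> (\<Union>n. G (r n))" using q antimonoD[OF assms(1)] by blast
qed (use r in blast)

lemma (in finite_measure) measure_UN_rat_above:
  fixes G :: "rat \<Rightarrow> 'a set" and t :: real
  assumes "antimono G" "\<And>q. G q \<in> sets M" and r: "decseq r" "\<And>n. t < of_rat (r n)" "\<And>n. of_rat (r n) < t + 1 / Suc n"
  shows "(\<lambda>n. measure M (G (r n))) \<longlonglongrightarrow> measure M (\<Union>q\<in>{q. t < of_rat q}. G q)"
  unfolding UN_rat_above_eq[OF assms(1) r(2,3)] using assms
  by (intro finite_Lim_measure_incseq) (auto simp: incseq_def decseq_def antimono_def)

text \<open>The level sets come first: nested events \<open>G q\<close>, for rational
  \<open>q\<close>, receive the mass that \<rho> gives to the half-line above \<open>q\<close>, and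
  \<open>Z\<close> is the supremum of the levels whose event contains the point. Then the law of
  \<open>Z\<close> and \<rho> agree on all half-lines, hence everywhere.\<close>

lemma (in finite_measure) nonatomic_unit_interval_law:
  fixes \<rho> :: "real measure"
  assumes na: "nonatomic_measure M" and "finite_measure \<rho>" and sets: "sets \<rho> = sets borel"
    and mass: "measure \<rho> UNIV = measure M (space M)" and conc: "measure \<rho> (- {0..1}) = 0"
  obtains Z where "Z \<in> borel_measurable M" "distr M borel Z = \<rho>"
proof -
  interpret r: finite_measure \<rho> by fact
  have sp: "space \<rho> = UNIV" using sets_eq_imp_space_eq[OF sets] by simp
  \<comment> \<open>\<open>nonatomic_chain\<close> yields increasing families, while the tail mass
    decreases in \<open>q\<close>; the sign is reversed here and restored in
    \<open>G\<close>.\<close>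
  define g where "g q = measure \<rho> {of_rat (- q) <..}" for q :: rat
  have "mono g" unfolding g_def
    by (intro monoI r.finite_measure_mono) (auto simp: sets of_rat_minus of_rat_less_eq intro: le_less_trans)
  moreover have "g q \<le> measure M (space M)" for q
    unfolding g_def mass[symmetric] by (intro r.finite_measure_mono) (auto simp: sets)
  ultimately obtain F where F: "\<And>q. F q \<in> sets M" "\<And>q. measure M (F q) = g q" "mono F"
    using nonatomic_chain[OF na, of g] by (metis g_def measure_nonneg)
  define G where "G q = F (- q)" for q
  have G: "\<And>q. G q \<in> sets M" "\<And>q. measure M (G q) = measure \<rho> {of_rat q <..}" "antimono G"
    using F by (auto simp: G_def g_def mono_def antimono_def)
  have up: "antimono (\<lambda>q::rat. {of_rat q <..} :: real set)" by (auto simp: antimono_def of_rat_less_eq intro: le_less_trans)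
  \<comment> \<open>Clipping the levels to the unit interval keeps the supremum finite, and a point
    outside \<open>G q\<close> contributes only 0. As \<rho> is concentrated on the unit interval,
    this does not disturb the law.\<close>
  define z where "z \<omega> q = (if \<omega> \<in> G q then max 0 (min 1 (real_of_rat q)) else 0)" for \<omega> q
  have bdd: "bdd_above (range (z \<omega>))" for \<omega> by (rule bdd_aboveI[of _ 1]) (auto simp: z_def)
  define Z where "Z \<omega> = (SUP q. z \<omega> q)" for \<omega>
  have Z: "Z \<in> borel_measurable M"
    unfolding Z_def using G(1) bdd
    by (intro borel_measurable_cSUP) (auto simp: z_def[abs_def])
  have less: "t < Z \<omega> \<longleftrightarrow> (\<exists>q. t < z \<omega> q)" for t \<omega>
    unfolding Z_def using bdd by (subst less_cSUP_iff) auto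
  have main: "measure M {\<omega>\<in>space M. t < Z \<omega>} = measure \<rho> {t <..}" for t
  proof -
    consider "t < 0" | "1 \<le> t" | "0 \<le> t" "t < 1" by linarith
    then show ?thesis
    proof cases
      case 1
      have "t < z \<omega> q" for \<omega> q using 1 by (auto simp: z_def)
      then have "{\<omega>\<in>space M. t < Z \<omega>} = space M" by (auto simp: less)
      moreover have "measure \<rho> {t <..} = measure \<rho> UNIV"
      proof (rule antisym)
        have "measure \<rho> UNIV \<le> measure \<rho> ({t <..} \<union> - {0..1})"
          using 1 by (intro r.finite_measure_mono) (auto simp: sets)
        also have "\<dots> \<le> measure \<rho> {t <..} + measure \<rho> (- {0..1})"
          by (intro measure_Un_le) (auto simp: sets)
        finally show "measure \<rho> UNIV \<le> measure \<rho> {t <..}" using conc by simp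
      qed (auto intro!: r.finite_measure_mono simp: sets)
      ultimately show ?thesis using mass by simp
    next
      case 2
      have "\<not> t < z \<omega> q" for \<omega> q using 2 by (auto simp: z_def)
      then have empty: "{\<omega>\<in>space M. t < Z \<omega>} = {}" by (auto simp: less)
      have "measure \<rho> {t <..} \<le> measure \<rho> (- {0..1})"
        using 2 by (intro r.finite_measure_mono) (auto simp: sets)
      then show ?thesis unfolding empty using conc by (simp add: measure_le_0_iff)
    next
      case 3
      have "t < z \<omega> q \<longleftrightarrow> \<omega> \<in> G q \<and> t < of_rat q" for \<omega> q using 3 by (auto simp: z_def)
      then have e1: "{\<omega>\<in>space M. t < Z \<omega>} = (\<Union>q\<in>{q. t < of_rat q}. G q)"
        using G(1) sets.sets_into_space by (fastforce simp: less)
      have e2: "{t <..} = (\<Union>q\<in>{q. t < real_of_rat q}. {real_of_rat q <..})"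
      proof (intro antisym subsetI)
        fix x assume "x \<in> {t <..}"
        then show "x \<in> (\<Union>q\<in>{q. t < real_of_rat q}. {real_of_rat q <..})" 
          using of_rat_dense[of t x] by auto
      qed auto
      obtain r where r: "decseq r" "\<And>n. t < real_of_rat (r n)" "\<And>n. real_of_rat (r n) < t + 1 / Suc n"
        using rat_decseq_above[of t] by metis
      \<comment> \<open>Tail masses are matched at rational levels only. Both sides are limits along
        the same rationals decreasing to \<open>t\<close>, which extends the equality to real
        \<open>t\<close>.\<close>
      show ?thesis unfolding e1 unfolding e2
        using measure_UN_rat_above[OF G(3,1) r] r.measure_UN_rat_above[OF up _ r] sets G(2)
        by (auto intro: LIMSEQ_unique)
    qed
  qed
  have "distr M borel Z = \<rho>"
  proof (rule measure_eqI_lessThan)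
    fix x :: real
    show "emeasure (distr M borel Z) {x<..} < \<infinity>" 
      using finite_measure.emeasure_finite[OF finite_measure_distr[OF Z]] by (simp add: top.not_eq_extremum)
    have "emeasure (distr M borel Z) {x<..} = emeasure M {\<omega>\<in>space M. x < Z \<omega>}"
      using Z by (subst emeasure_distr) (auto intro!: arg_cong[where f="emeasure M"])
    then show "emeasure (distr M borel Z) {x<..} = emeasure \<rho> {x<..}"
      using main by (simp add: emeasure_eq_measure r.emeasure_eq_measure)
  qed (auto simp: sets)
  then show thesis using Z that by blast
qed

section \<open>Borel coding of Euclidean space in the unit interval\<close>

text \<open>Base 3 with digits 0 and 1 only avoids the ambiguity of binary expansions: a leading 0
  leaves at most 1/6, a leading 1 gives at least 1/3, so comparison with 1/3 reads the first
  bit.\<close>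

definition ternary :: "(nat \<Rightarrow> bool) \<Rightarrow> real" where
  "ternary b = (\<Sum>n. of_bool (b n) / 3 ^ Suc n)"

text \<open>On codes this drops the first \<open>n\<close> digits. It is given by arithmetic on
  every real, so that the decoder is Borel on the whole line and not just defined on the range of
  \<open>ternary\<close>.\<close>

fun ternary_shift :: "nat \<Rightarrow> real \<Rightarrow> real" where
  "ternary_shift 0 t = t"
| "ternary_shift (Suc n) t = 3 * ternary_shift n t - of_bool (1 / 3 \<le> ternary_shift n t)"

lemma summable_ternary: "summable (\<lambda>n. of_bool (b n) / 3 ^ Suc n :: real)"
proof (rule summable_comparison_test')
  show "summable (\<lambda>n. (1 / 3) * (1 / 3 :: real) ^ n)" by (intro summable_mult summable_geometric) simp
qed (auto simp: power_one_over field_simps)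

lemma ternary_bounds: "0 \<le> ternary b" "ternary b \<le> 1 / 2"
proof -
  have geo: "(\<lambda>n. (1 / 3) * (1 / 3 :: real) ^ n) sums ((1 / 3) * (1 / (1 - 1 / 3)))"
    by (intro sums_mult geometric_sums) simp
  have "ternary b \<le> (\<Sum>n. (1 / 3) * (1 / 3) ^ n)"
    unfolding ternary_def using summable_ternary sums_summable[OF geo]
    by (intro suminf_le) (auto simp: power_one_over field_simps)
  then show "ternary b \<le> 1 / 2" using sums_unique[OF geo] by simp
  show "0 \<le> ternary b" unfolding ternary_def by (intro suminf_nonneg summable_ternary) auto
qed

lemma ternary_Suc: "ternary b = (of_bool (b 0) + ternary (\<lambda>n. b (Suc n))) / 3"
proof -
  have "ternary b = (\<Sum>n. of_bool (b (Suc n)) / 3 ^ Suc (Suc n)) + of_bool (b 0) / 3"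
    unfolding ternary_def using suminf_split_head[OF summable_ternary[of b]] by simp
  also have "(\<Sum>n. of_bool (b (Suc n)) / 3 ^ Suc (Suc n)) = ternary (\<lambda>n. b (Suc n)) / 3"
    unfolding ternary_def using suminf_divide[OF summable_ternary[of "\<lambda>n. b (Suc n)"], of 3]
    by (simp add: mult.commute)
  finally show ?thesis by simp
qed

lemma ternary_ge_iff: "1 / 3 \<le> ternary b \<longleftrightarrow> b 0"
  using ternary_bounds[of "\<lambda>n. b (Suc n)"] by (simp add: ternary_Suc[of b])

lemma ternary_shift_ternary: "ternary_shift n (ternary b) = ternary (\<lambda>k. b (k + n))"
proof (induction n)
  case (Suc n)
  have "b n \<longleftrightarrow> 1 / 3 \<le> ternary (\<lambda>k. b (k + n))" by (unfold ternary_ge_iff) simp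
  then have "ternary_shift (Suc n) (ternary b) = 3 * ternary (\<lambda>k. b (k + n)) - of_bool (b n)"
    using Suc by (simp only: ternary_shift.simps)
  moreover have "3 * ternary (\<lambda>k. b (k + n)) = of_bool (b n) + ternary (\<lambda>k. b (k + Suc n))"
    using ternary_Suc[of "\<lambda>k. b (k + n)"] by simp
  ultimately show ?case by linarith
qed simp

lemma borel_measurable_ternary_shift[measurable]: "ternary_shift n \<in> borel_measurable borel"
  by (induction n) auto

text \<open>A point is determined by the answers to the countably many questions whether
  \<open>x \<bullet> i < q\<close>, with \<open>i\<close> a basis vector and \<open>q\<close>
  rational. The answers are packed into one real by \<open>ternary\<close>, and each coordinate is
  recovered as the infimum of the \<open>q\<close> answered positively.\<close>

lemma euclidean_unit_interval_encoding:
  obtains h :: "'b::euclidean_space \<Rightarrow> real" and g where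
    "h \<in> borel_measurable borel" "range h \<subseteq> {0..1}" "g \<in> borel_measurable borel" "\<And>x. g (h x) = x"
proof -
  define E where "E = (Basis :: 'b set) \<times> (\<rat> :: real set)"
  have E: "countable E" "E \<noteq> {}" using countable_finite[OF finite_Basis] countable_rat Rats_0 nonempty_Basis by (auto simp: E_def intro!: countable_SIGMA)
  define e where "e = from_nat_into E"
  define h where "h x = ternary (\<lambda>n. x \<bullet> fst (e n) < snd (e n))" for x
  define d where "d t p \<longleftrightarrow> 1 / 3 \<le> ternary_shift (to_nat_on E p) t" for t p
  \<comment> \<open>The value \<infinity> for a negative answer turns an infimum over a set
    depending on \<open>t\<close> into one over the fixed countable set of rationals, which gives
    measurability. In \<open>ereal\<close> it exists for every \<open>t\<close>, whether or not
    \<open>t\<close> is a code.\<close>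
  define c where "c t i = real_of_ereal (INF q\<in>\<rat>. if d t (i, q) then ereal q else \<infinity>)" for t i
  define g where "g t = (\<Sum>i\<in>Basis. c t i *\<^sub>R i)" for t
  have "{x. x \<bullet> fst (e n) < snd (e n)} \<in> sets borel" for n
    by (intro borel_open open_Collect_less continuous_intros)
  then have "h \<in> borel_measurable borel"
    unfolding h_def ternary_def of_bool_def
    by (intro borel_measurable_suminf borel_measurable_divide measurable_If borel_measurable_const) simp_all
  moreover have "range h \<subseteq> {0..1}" using ternary_bounds order_trans[OF ternary_bounds(2)] by (auto simp: h_def)
  moreover have "(\<lambda>t. c t i) \<in> borel_measurable borel" for i
  proof -
    have [measurable]: "Measurable.pred borel (\<lambda>t. d t (i, q))" for q
      unfolding d_def by measurable
    show ?thesis unfolding c_def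
      by (intro borel_measurable_real_of_ereal borel_measurable_INF countable_rat) measurable
  qed
  then have "g \<in> borel_measurable borel" unfolding g_def by measurable
  moreover have "g (h x) = x" for x
  proof -
    have d: "d (h x) (i, q) \<longleftrightarrow> x \<bullet> i < q" if "i \<in> Basis" "q \<in> \<rat>" for i q
    proof -
      have "e (to_nat_on E (i, q)) = (i, q)" using that E unfolding e_def by (intro from_nat_into_to_nat_on) (auto simp: E_def)
      then show ?thesis unfolding d_def h_def ternary_shift_ternary ternary_ge_iff by simp
    qed
    have "c (h x) i = x \<bullet> i" if i: "i \<in> Basis" for i
    proof -
      have "(INF q\<in>\<rat>. if d (h x) (i, q) then ereal q else \<infinity>) = ereal (x \<bullet> i)"
      proof (rule antisym)
        show "ereal (x \<bullet> i) \<le> (INF q\<in>\<rat>. if d (h x) (i, q) then ereal q else \<infinity>)"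
          using d[OF i] by (intro INF_greatest) auto
        show "(INF q\<in>\<rat>. if d (h x) (i, q) then ereal q else \<infinity>) \<le> ereal (x \<bullet> i)"
        proof (rule ccontr)
          assume "\<not> ?thesis"
          then have "ereal (x \<bullet> i) < (INF q\<in>\<rat>. if d (h x) (i, q) then ereal q else \<infinity>)"
            by (simp only: not_le)
          then obtain r where r: "ereal (x \<bullet> i) < ereal r"
              "ereal r < (INF q\<in>\<rat>. if d (h x) (i, q) then ereal q else \<infinity>)"
            using ereal_dense2 by blast
          then obtain q where q: "q \<in> \<rat>" "x \<bullet> i < q" "q < r" using Rats_dense_in_real[of "x \<bullet> i" r] by auto
          then have "(INF q\<in>\<rat>. if d (h x) (i, q) then ereal q else \<infinity>) \<le> ereal q"
            using d[OF i q(1)] by (intro INF_lower2[OF q(1)]) auto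
          also have "ereal q < ereal r" using q by simp
          finally show False using r(2) by simp
        qed
      qed
      then show ?thesis by (simp add: c_def)
    qed
    then show ?thesis by (simp add: g_def euclidean_representation)
  qed
  ultimately show thesis using that by blast
qed

text \<open>Transport \<open>\<rho>\<close> to the unit interval by the encoding, realise the image there, and decode;
  the decoder is modified off \<open>T\<close> so that the decoded variable never leaves \<open>T\<close>.\<close>

lemma (in finite_measure) nonatomic_law:
  fixes T :: "'b::euclidean_space set" and \<rho> :: "'b measure"
  assumes na: "nonatomic_measure M" and T: "T \<in> sets borel" "T \<noteq> {}"
    and "finite_measure \<rho>" and sets: "sets \<rho> = sets (borel_on T)"
    and mass: "measure \<rho> T = measure M (space M)"
  obtains Y where "Y \<in> rvs M T" "law M T Y = \<rho>"
proof -
  interpret r: finite_measure \<rho> by fact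
  have sp: "space \<rho> = T" using sets_eq_imp_space_eq[OF sets] by (simp add: space_restrict_space)
  obtain h g where hg[measurable]: "h \<in> borel_measurable borel" "g \<in> borel_measurable borel"
    and h: "range h \<subseteq> {0..1::real}" and gh: "\<And>x::'b. g (h x) = x"
    using euclidean_unit_interval_encoding by metis
  obtain y0 where y0: "y0 \<in> T" using T by blast
  define g' where "g' t = (if g t \<in> T then g t else y0)" for t
  have hm: "h \<in> borel_measurable \<rho>"
    using measurable_restrict_space1[OF hg(1), of T] measurable_cong_sets[OF sets refl] by blast
  have "g' \<in> borel_measurable borel" unfolding g'_def using T by measurable
  then have gm: "g' \<in> measurable borel (borel_on T)"
    using y0 by (intro measurable_restrict_space2) (auto simp: g'_def)
  interpret d: finite_measure "distr \<rho> borel h" by (rule r.finite_measure_distr[OF hm])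
  have "measure (distr \<rho> borel h) UNIV = measure M (space M)"
    using hm by (subst measure_distr) (auto simp: sp mass)
  moreover have "h -` (- {0..1}) = {}" using h by auto
  then have "measure (distr \<rho> borel h) (- {0..1}) = 0"
    using hm by (subst measure_distr) auto
  ultimately obtain Z where Z: "Z \<in> borel_measurable M" "distr M borel Z = distr \<rho> borel h"
    using nonatomic_unit_interval_law[OF na d.finite_measure_axioms] by auto
  have "distr M (borel_on T) (g' \<circ> Z) = distr (distr M borel Z) (borel_on T) g'"
    using gm Z(1) by (simp add: distr_distr)
  also have "\<dots> = distr \<rho> (borel_on T) (g' \<circ> h)"
    unfolding Z(2) using gm hm by (simp add: distr_distr)
  also have "\<dots> = distr \<rho> \<rho> (\<lambda>x. x)"
    using gh sp by (intro distr_cong) (auto simp: sets g'_def)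
  finally have "distr M (borel_on T) (g' \<circ> Z) = \<rho>" by (simp add: distr_id)
  moreover have "g' \<circ> Z \<in> rvs M T" using gm Z by simp
  ultimately show thesis using that by blast
qed


section \<open>Rearranging a random variable\<close>

text \<open>The weights cut the law of \<open>Y\<close> into pieces \<open>\<rho> i\<close> whose
  masses are those of the events \<open>E i\<close>. Each piece is realised on its own event and the
  results are glued. Since the weights sum to 1, the pieces add up to the law of
  \<open>Y\<close>.\<close>

lemma (in prob_space) nonatomic_rearrange:
  fixes T :: "'b::euclidean_space set" and w :: "nat \<Rightarrow> 'a \<Rightarrow> real"
  assumes na: "nonatomic_measure M" and T: "T \<in> sets borel" and Y: "Y \<in> rvs M T"
    and E: "\<And>i. i < n \<Longrightarrow> E i \<in> sets M" "disjoint_family_on E {..<n}" "(\<Union>i<n. E i) = space M"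
    and w: "\<And>i. i < n \<Longrightarrow> w i \<in> borel_measurable M" "\<And>i \<omega>. i < n \<Longrightarrow> \<omega> \<in> space M \<Longrightarrow> 0 \<le> w i \<omega>"
      "\<And>\<omega>. \<omega> \<in> space M \<Longrightarrow> (\<Sum>i<n. w i \<omega>) = 1"
    and Ew: "\<And>i. i < n \<Longrightarrow> measure M (E i) = (\<integral>\<omega>. w i \<omega> \<partial>M)"
  obtains Y' where "Y' \<in> rvs M T" "law M T Y' = law M T Y"
    "\<forall>i<n. \<forall>f\<in>borel_measurable (borel_on T).
      (\<integral>\<omega>. indicator (E i) \<omega> * f (Y' \<omega>) \<partial>M) = (\<integral>\<omega>. w i \<omega> * f (Y \<omega>) \<partial>M :: real)"
proof -
  have TY: "Y \<omega> \<in> T" if "\<omega> \<in> space M" for \<omega>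
    using measurable_space[OF Y that] by (simp add: space_restrict_space)
  then have Tne: "T \<noteq> {}" using not_empty by blast
  have w1: "w i \<omega> \<le> 1" if "i < n" "\<omega> \<in> space M" for i \<omega>
    using member_le_sum[of i "{..<n}" "\<lambda>i. w i \<omega>"] w that by auto
  have wint: "integrable M (w i)" if "i < n" for i
    using w w1 that by (intro integrable_const_bound[where B = 1]) auto
  define \<rho> where "\<rho> i = distr (density M (\<lambda>\<omega>. ennreal (w i \<omega>))) (borel_on T) Y" for i
  have "\<exists>Z \<in> rvs (restrict_space M (E i)) T. law (restrict_space M (E i)) T Z = \<rho> i" if i: "i < n" for i
  proof -
    have mass: "emeasure (density M (\<lambda>\<omega>. ennreal (w i \<omega>))) (space M) = ennreal (measure M (E i))"
      using w i wint Ew by (simp add: emeasure_density nn_integral_eq_integral cong: nn_integral_cong)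
    then interpret d: finite_measure "density M (\<lambda>\<omega>. ennreal (w i \<omega>))"
      by (intro finite_measureI) auto
    have Yd: "Y \<in> measurable (density M (\<lambda>\<omega>. ennreal (w i \<omega>))) (borel_on T)" using Y by simp
    interpret r: finite_measure "restrict_space M (E i)"
      using E i by (intro finite_measure_restrict_space) auto
    have "measure (\<rho> i) T = measure (density M (\<lambda>\<omega>. ennreal (w i \<omega>))) (Y -` T \<inter> space M)"
      using Yd T unfolding \<rho>_def by (subst measure_distr) (auto simp: sets_restrict_space_iff)
    also have "Y -` T \<inter> space M = space M" using TY by auto
    also have "measure (density M (\<lambda>\<omega>. ennreal (w i \<omega>))) (space M) = measure M (E i)"
      using mass by (simp add: measure_def)
    also have "\<dots> = measure (restrict_space M (E i)) (space (restrict_space M (E i)))"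
      using E i sets.sets_into_space[OF E(1)[OF i]]
      by (subst measure_restrict_space) (auto simp: space_restrict_space Int_absorb2)
    finally show ?thesis
      using r.nonatomic_law[OF nonatomic_measure_restrict[OF na E(1)[OF i]] T Tne, of "\<rho> i"]
        d.finite_measure_distr[OF Yd] unfolding \<rho>_def by (metis sets_distr)
  qed
  then obtain Z where Z: "\<And>i. i < n \<Longrightarrow> Z i \<in> rvs (restrict_space M (E i)) T"
      "\<And>i. i < n \<Longrightarrow> law (restrict_space M (E i)) T (Z i) = \<rho> i" by metis
  \<comment> \<open>The events partition \<open>space M\<close>, so the choice of \<open>i\<close>
    is forced there.\<close>
  define Y' where "Y' \<omega> = Z (SOME i. i < n \<and> \<omega> \<in> E i) \<omega>" for \<omega>
  have Y'Z: "Y' \<omega> = Z i \<omega>" if "i < n" "\<omega> \<in> E i" for i \<omega>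
  proof -
    have "(SOME i. i < n \<and> \<omega> \<in> E i) = i"
      using that E(2) by (intro some_equality) (auto simp: disjoint_family_on_def)
    then show ?thesis by (simp add: Y'_def)
  qed
  have Y'm: "Y' \<in> rvs M T"
  proof (rule measurable_piecewise_restrict[of "E ` {..<n}"])
    fix S assume "S \<in> E ` {..<n}"
    then obtain i where i: "i < n" "S = E i" by blast
    then show "S \<inter> space M \<in> sets M" using E by auto
    show "Y' \<in> rvs (restrict_space M S) T"
      using Z(1)[OF i(1)] Y'Z[OF i(1)] unfolding i(2)
      by (subst measurable_cong[of _ _ "Z i"]) (auto simp: space_restrict_space)
  qed (use E in auto)
  have int: "(\<integral>\<omega>. indicator (E i) \<omega> * f (Y' \<omega>) \<partial>M) = (\<integral>\<omega>. w i \<omega> * f (Y \<omega>) \<partial>M)"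
    if i: "i < n" and f: "f \<in> borel_measurable (borel_on T)" for i and f :: "'b \<Rightarrow> real"
  proof -
    have "(\<integral>\<omega>. indicator (E i) \<omega> * f (Y' \<omega>) \<partial>M) = (\<integral>\<omega>. indicator (E i) \<omega> * f (Z i \<omega>) \<partial>M)"
      using Y'Z[OF i] by (intro Bochner_Integration.integral_cong) (auto simp: indicator_def)
    also have "\<dots> = (\<integral>\<omega>. f (Z i \<omega>) \<partial>restrict_space M (E i))"
      using E(1)[OF i] by (subst integral_restrict_space) (auto simp: set_lebesgue_integral_def)
    also have "\<dots> = (\<integral>y. f y \<partial>\<rho> i)"
      using Z[OF i] f by (simp add: integral_distr flip: Z(2)[OF i])
    also have "\<dots> = (\<integral>\<omega>. f (Y \<omega>) \<partial>density M (\<lambda>\<omega>. ennreal (w i \<omega>)))"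
      unfolding \<rho>_def using Y f by (intro integral_distr) auto
    also have "\<dots> = (\<integral>\<omega>. w i \<omega> * f (Y \<omega>) \<partial>M)"
      using w i measurable_compose[OF Y f] by (intro integral_real_density) auto
    finally show ?thesis .
  qed
  have "law M T Y' = law M T Y"
  proof (rule measure_eqI)
    fix B assume "B \<in> sets (law M T Y')"
    then have B: "B \<in> sets (borel_on T)" by simp
    have bm: "(indicator B :: 'b \<Rightarrow> real) \<in> borel_measurable (borel_on T)" using B by simp
    \<comment> \<open>Applied to \<open>Y'\<close> with the indicators of the events and to
      \<open>Y\<close> with the weights; \<open>int\<close> equates the two sums term by
      term.\<close>
    have split: "(\<integral>\<omega>. indicator B (V \<omega>) \<partial>M) = (\<Sum>i<n. \<integral>\<omega>. u i \<omega> * indicator B (V \<omega>) \<partial>M)"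
      if V: "V \<in> rvs M T" and u: "\<And>i. i < n \<Longrightarrow> u i \<in> borel_measurable M" 
        "\<And>i \<omega>. i < n \<Longrightarrow> \<omega> \<in> space M \<Longrightarrow> \<bar>u i \<omega>\<bar> \<le> 1" "\<And>\<omega>. \<omega> \<in> space M \<Longrightarrow> (\<Sum>i<n. u i \<omega>) = 1"
      for V and u :: "nat \<Rightarrow> 'a \<Rightarrow> real"
    proof -
      have "integrable M (\<lambda>\<omega>. u i \<omega> * indicator B (V \<omega>))" if "i < n" for i
        using u that measurable_compose[OF V bm]
        by (intro integrable_const_bound[where B = 1]) (auto simp: indicator_def)
      then have "(\<Sum>i<n. \<integral>\<omega>. u i \<omega> * indicator B (V \<omega>) \<partial>M) = (\<integral>\<omega>. (\<Sum>i<n. u i \<omega> * indicator B (V \<omega>)) \<partial>M)"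
        by (subst Bochner_Integration.integral_sum) auto
      also have "\<dots> = (\<integral>\<omega>. indicator B (V \<omega>) \<partial>M)"
        unfolding sum_distrib_right[symmetric] using u(3) by (intro Bochner_Integration.integral_cong) auto
      finally show ?thesis by simp
    qed
    have E1: "(\<Sum>i<n. indicator (E i) \<omega>) = (1::real)" if "\<omega> \<in> space M" for \<omega>
      using sum_indicator_disjoint_family[of "\<lambda>_. 1"] indicator_UN_disjoint[of "{..<n}" E \<omega>] E that by simp
    have meas: "measure (law M T V) B = (\<integral>\<omega>. indicator B (V \<omega>) \<partial>M)" if "V \<in> rvs M T" for V
    proof -
      have "V -` B \<inter> space M \<in> sets M" using that B by (rule measurable_sets)
      moreover have "(\<integral>\<omega>. indicator B (V \<omega>) \<partial>M) = (\<integral>\<omega>. indicator (V -` B \<inter> space M) \<omega> \<partial>M :: real)"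
        by (intro Bochner_Integration.integral_cong) (auto simp: indicator_def)
      ultimately show ?thesis using that B by (simp add: measure_distr)
    qed
    have "measure (law M T Y') B = measure (law M T Y) B"
      unfolding meas[OF Y'm] meas[OF Y]
      using split[OF Y'm, of "\<lambda>i. indicator (E i)"] split[OF Y, of w] E(1) E1 w w1 int[OF _ bm]
      by (simp add: indicator_def abs_le_iff order_trans[of _ 0])
    then show "emeasure (law M T Y') B = emeasure (law M T Y) B"
      using Y'm Y by (simp add: finite_measure.emeasure_eq_measure finite_measure_distr)
  qed simp
  moreover have "\<forall>i<n. \<forall>f\<in>borel_measurable (borel_on T).
      (\<integral>\<omega>. indicator (E i) \<omega> * f (Y' \<omega>) \<partial>M) = (\<integral>\<omega>. w i \<omega> * f (Y \<omega>) \<partial>M :: real)"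
    by (intro allI impI ballI int)
  ultimately show thesis by (rule that[OF Y'm])
qed

section \<open>Weak convergence and open neighbourhoods\<close>

text \<open>A Urysohn function lies between the indicators of \<open>K\<close> and \<open>G\<close>,
  and its integrals converge. This is the form of the portmanteau inequality needed for cells and
  their neighbourhoods.\<close>

lemma (in prob_space) weakly_converges_open_lower:
  fixes S :: "'b::euclidean_space set"
  assumes X: "X \<in> rvs M S" "\<And>k. Xs k \<in> rvs M S"
    and conv: "weakly_converges S (\<lambda>k. law M S (Xs k)) (law M S X)"
    and K: "closed K" "open G" "K \<subseteq> G" and "a < measure M {\<omega>\<in>space M. X \<omega> \<in> K}"
  shows "\<forall>\<^sub>F k in sequentially. a < measure M {\<omega>\<in>space M. Xs k \<omega> \<in> G}"
proof -
  obtain f :: "'b \<Rightarrow> real" where f: "continuous_on UNIV f" "\<And>x. f x \<in> closed_segment 1 0"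
      "\<And>x. x \<in> K \<Longrightarrow> f x = 1" "\<And>x. x \<in> - G \<Longrightarrow> f x = 0"
    using Urysohn[of K "- G" 1 0] K by (auto simp: closed_Compl)
  have f01: "0 \<le> f x" "f x \<le> 1" for x using f(2)[of x] by (auto simp: closed_segment_eq_real_ivl)
  have fS: "continuous_on S f" using f(1) continuous_on_subset by blast
  have fm: "f \<in> borel_measurable borel" using f(1) by (rule borel_measurable_continuous_onI)
  have b: "bounded (f ` S)" using f01 by (auto intro!: boundedI[of _ 1])
  have V: "V \<in> borel_measurable M" if "V \<in> rvs M S" for V
    using that by (simp add: measurable_restrict_space2_iff)
  have int: "integrable M (\<lambda>\<omega>. f (V \<omega>))" if "V \<in> rvs M S" for V
    using f01 fm V[OF that] by (intro integrable_const_bound[where B = 1]) auto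
  have "(\<lambda>k. \<integral>x. f x \<partial>law M S (Xs k)) \<longlonglongrightarrow> (\<integral>x. f x \<partial>law M S X)"
    using conv fS b unfolding weakly_converges_def by blast
  then have lim: "(\<lambda>k. \<integral>\<omega>. f (Xs k \<omega>) \<partial>M) \<longlonglongrightarrow> (\<integral>\<omega>. f (X \<omega>) \<partial>M)"
    using X fm by (simp add: integral_distr measurable_restrict_space1)
  have ind: "integrable M (indicator A :: 'a \<Rightarrow> real)" if "A \<in> sets M" for A
    using that by (simp add: integrable_real_indicator emeasure_eq_measure)
  note V[OF X(1), measurable] V[OF X(2), measurable] borel_closed[OF K(1), measurable] borel_open[OF K(2), measurable]
  have Ks: "{\<omega>\<in>space M. X \<omega> \<in> K} \<in> sets M" by measurable
  have "a < (\<integral>\<omega>. indicator {\<omega>\<in>space M. X \<omega> \<in> K} \<omega> \<partial>M)"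
    using Ks assms by (simp add: Int_absorb2 Collect_mono)
  also have "\<dots> \<le> (\<integral>\<omega>. f (X \<omega>) \<partial>M)"
    using f f01 by (intro integral_mono ind Ks int[OF X(1)]) (auto simp: indicator_def)
  finally have "\<forall>\<^sub>F k in sequentially. a < (\<integral>\<omega>. f (Xs k \<omega>) \<partial>M)"
    using lim by (simp add: order_tendstoD)
  moreover have "(\<integral>\<omega>. f (Xs k \<omega>) \<partial>M) \<le> measure M {\<omega>\<in>space M. Xs k \<omega> \<in> G}" for k
  proof -
    have Gs: "{\<omega>\<in>space M. Xs k \<omega> \<in> G} \<in> sets M" by measurable
    have "(\<integral>\<omega>. f (Xs k \<omega>) \<partial>M) \<le> (\<integral>\<omega>. indicator {\<omega>\<in>space M. Xs k \<omega> \<in> G} \<omega> \<partial>M)"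
      using f f01 by (intro integral_mono ind Gs int[OF X(2)]) (auto simp: indicator_def)
    then show ?thesis using Gs by simp
  qed
  ultimately show ?thesis by (auto elim!: eventually_mono intro: less_le_trans)
qed


section \<open>Disjoint compact cells\<close>

lemma inner_regular_measure:
  fixes \<mu> :: "'b::euclidean_space measure"
  assumes "finite_measure \<mu>" and sets: "sets \<mu> = sets borel" and B: "B \<in> sets borel" and "0 < e"
  obtains K where "compact K" "K \<subseteq> B" "measure \<mu> B - e < measure \<mu> K"
proof (cases "measure \<mu> B = 0")
  \<comment> \<open>\<open>ennreal\<close> truncates \<open>- e\<close> to 0, so the strict
    inequality used in the other case would fail for a null set; the empty set serves
    instead.\<close>
  case True
  then show thesis using that[of "{}"] \<open>0 < e\<close> by simp
next
  case False
  interpret finite_measure \<mu> by fact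
  have "ennreal (measure \<mu> B - e) < emeasure \<mu> B"
    unfolding emeasure_eq_measure using False \<open>0 < e\<close> measure_nonneg[of \<mu> B] by (intro ennreal_lessI) linarith+
  also have "emeasure \<mu> B = (SUP K \<in> {K. K \<subseteq> B \<and> compact K}. emeasure \<mu> K)"
    using emeasure_finite by (intro inner_regular sets B) auto
  finally obtain K where "K \<subseteq> B" "compact K" "ennreal (measure \<mu> B - e) < ennreal (measure \<mu> K)"
    by (auto simp: less_SUP_iff emeasure_eq_measure)
  then show thesis using that by (metis ennreal_leI not_less)
qed

text \<open>Cover \<open>S\<close> by finitely many balls of radius \<open>\<delta> / 2\<close>,
  make them disjoint, and shrink each resulting Borel piece to a compact set by inner
  regularity.\<close>

lemma compact_cells:
  fixes \<mu> :: "'b::euclidean_space measure"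
  assumes "finite_measure \<mu>" and sets: "sets \<mu> = sets borel" and S: "compact S"
    and "0 < \<delta>" and "0 < e"
  obtains n :: nat and K where "\<And>i. i < n \<Longrightarrow> compact (K i)" "\<And>i. i < n \<Longrightarrow> K i \<subseteq> S"
    "disjoint_family_on K {..<n}" "\<And>i x y. i < n \<Longrightarrow> x \<in> K i \<Longrightarrow> y \<in> K i \<Longrightarrow> dist x y < \<delta>"
    "measure \<mu> S - e \<le> (\<Sum>i<n. measure \<mu> (K i))"
proof -
  interpret finite_measure \<mu> by fact
  have "\<exists>I. finite I \<and> S \<subseteq> (\<Union>x\<in>I. ball x (\<delta> / 2))"
    using S \<open>0 < \<delta>\<close> unfolding compact_eq_totally_bounded by (meson half_gt_zero)
  then obtain I where I: "finite I" "S \<subseteq> (\<Union>x\<in>I. ball x (\<delta> / 2))" by blast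
  obtain n :: nat and c where c: "I = c ` {i. i < n}"
    using finite_imp_nat_seg_image_inj_on[OF I(1)] by metis
  define B where "B i = S \<inter> disjointed (\<lambda>i. ball (c i) (\<delta> / 2)) i" for i
  have Bs: "B i \<in> sets borel" for i
    using compact_imp_closed[OF S] by (auto simp: B_def disjointed_def)
  have disj: "disjoint_family_on B {..<n}"
    using disjoint_family_disjointed[of "\<lambda>i. ball (c i) (\<delta> / 2)"]
    by (auto simp: B_def disjoint_family_on_def)
  have "(\<Union>x\<in>I. ball x (\<delta> / 2)) = (\<Union>i\<in>{0..<n}. disjointed (\<lambda>i. ball (c i) (\<delta> / 2)) i)"
    unfolding c finite_UN_disjointed_eq by auto
  then have SB: "S = (\<Union>i<n. B i)"
    using I(2) unfolding B_def by (auto simp: lessThan_atLeast0)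
  \<comment> \<open>Each of the \<open>n\<close> pieces may lose \<open>e / Suc n\<close>, at most
    \<open>e\<close> in total; the successor covers \<open>n = 0\<close>.\<close>
  have "\<exists>K. compact K \<and> K \<subseteq> B i \<and> measure \<mu> (B i) - e / Suc n < measure \<mu> K" for i
    using inner_regular_measure[OF assms(1) sets Bs, of "e / Suc n" i] \<open>0 < e\<close> by (metis divide_pos_pos of_nat_0_less_iff zero_less_Suc)
  then obtain K where K: "\<And>i. compact (K i)" "\<And>i. K i \<subseteq> B i"
      "\<And>i. measure \<mu> (B i) - e / Suc n < measure \<mu> (K i)" by metis
  show thesis
  proof
    show "K i \<subseteq> S" for i using K(2) by (auto simp: B_def)
    show "disjoint_family_on K {..<n}" using disj K(2) unfolding disjoint_family_on_def by blast
    show "dist x y < \<delta>" if "x \<in> K i" "y \<in> K i" for i x y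
    proof -
      have "x \<in> ball (c i) (\<delta> / 2)" "y \<in> ball (c i) (\<delta> / 2)"
        using K(2) that disjointed_subset[of "\<lambda>i. ball (c i) (\<delta> / 2)" i] unfolding B_def by blast+
      then show ?thesis by (auto intro: dist_triangle_half_r)
    qed
    have "measure \<mu> S = (\<Sum>i<n. measure \<mu> (B i))"
      unfolding SB using disj Bs sets by (intro finite_measure_finite_Union) auto
    also have "\<dots> \<le> (\<Sum>i<n. measure \<mu> (K i) + e / Suc n)"
      using K(3) by (intro sum_mono) (simp add: less_imp_le algebra_simps)
    also have "\<dots> \<le> (\<Sum>i<n. measure \<mu> (K i)) + e"
    proof -
      have "n * (e / Suc n) \<le> e" using \<open>0 < e\<close> by (simp add: field_simps)
      then show ?thesis by (simp add: sum.distrib)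
    qed
    finally show "measure \<mu> S - e \<le> (\<Sum>i<n. measure \<mu> (K i))" by simp
  qed (use K in auto)
qed

text \<open>Disjoint compact sets have positive distance. The filter \<open>at_right 0\<close>
  merges the finitely many pairwise bounds into one \<open>d\<close>, and balls of radius
  \<open>d / 2\<close> around different sets cannot meet.\<close>

lemma disjoint_compacts_separated:
  fixes K :: "nat \<Rightarrow> 'b::euclidean_space set"
  assumes "\<And>i. i < n \<Longrightarrow> compact (K i)" "disjoint_family_on K {..<n}" "0 < \<delta>"
  obtains r where "0 < r" "r \<le> \<delta>" "disjoint_family_on (\<lambda>i. \<Union>a\<in>K i. ball a r) {..<n}"
proof -
  have d1: "\<exists>d>0. \<forall>x\<in>K i. \<forall>y\<in>K j. d \<le> dist x y" if "i < n" "j < n" "i \<noteq> j" for i j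
    using that assms by (intro separate_compact_closed compact_imp_closed) (auto simp: disjoint_family_on_def)
  have "\<forall>\<^sub>F d in at_right 0. i \<noteq> j \<longrightarrow> (\<forall>x\<in>K i. \<forall>y\<in>K j. d \<le> dist x y)" if "i < n" "j < n" for i j
  proof (cases "i = j")
    case False
    then obtain b where "0 < b" "\<forall>x\<in>K i. \<forall>y\<in>K j. b \<le> dist x y" using d1 \<open>i < n\<close> \<open>j < n\<close> by blast
    then show ?thesis unfolding eventually_at_right_field by (intro exI[of _ b]) force
  qed simp
  then have "\<forall>\<^sub>F d in at_right 0. \<forall>i\<in>{..<n}. \<forall>j\<in>{..<n}. i \<noteq> j \<longrightarrow> (\<forall>x\<in>K i. \<forall>y\<in>K j. d \<le> dist x y)"
    by (intro eventually_ball_finite ballI) auto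
  moreover have "\<forall>\<^sub>F d in at_right (0::real). d < \<delta>" using \<open>0 < \<delta>\<close> by (auto simp: eventually_at_right_field)
  moreover have "\<forall>\<^sub>F d in at_right (0::real). 0 < d" by (simp add: eventually_at_right_less)
  ultimately have "\<forall>\<^sub>F d in at_right 0. 0 < d \<and> d < \<delta> \<and>
      (\<forall>i\<in>{..<n}. \<forall>j\<in>{..<n}. i \<noteq> j \<longrightarrow> (\<forall>x\<in>K i. \<forall>y\<in>K j. d \<le> dist x y))"
    by eventually_elim auto
  then obtain d where d: "0 < d" "d < \<delta>"
      "\<And>i j x y. i < n \<Longrightarrow> j < n \<Longrightarrow> i \<noteq> j \<Longrightarrow> x \<in> K i \<Longrightarrow> y \<in> K j \<Longrightarrow> d \<le> dist x y"
    by (auto dest!: eventually_happens)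
  have "(\<Union>a\<in>K i. ball a (d / 2)) \<inter> (\<Union>a\<in>K j. ball a (d / 2)) = {}" if "i < n" "j < n" "i \<noteq> j" for i j
  proof (rule equals0I)
    fix z assume "z \<in> (\<Union>a\<in>K i. ball a (d / 2)) \<inter> (\<Union>a\<in>K j. ball a (d / 2))"
    then obtain x y where xy: "x \<in> K i" "y \<in> K j" "dist x z < d / 2" "dist y z < d / 2" by auto
    then show False using d(3)[OF that xy(1,2)] dist_triangle_half_l[of x z d y] by auto
  qed
  then have "disjoint_family_on (\<lambda>i. \<Union>a\<in>K i. ball a (d / 2)) {..<n}"
    unfolding disjoint_family_on_def by blast
  then show thesis using that[of "d / 2"] d by simp
qed


section \<open>Upper semicontinuity of the worst-case utility\<close>

text \<open>Index \<open>n\<close> stands for the remainder, where only the crude bound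
  \<open>d\<close> is available and is paid in proportion to the weight \<open>v n\<close>; every
  other index of nonzero weight costs at most \<open>c\<close>.\<close>

lemma convex_comb_error:
  fixes v g :: "nat \<Rightarrow> real"
  assumes v: "\<And>i. i \<le> n \<Longrightarrow> 0 \<le> v i" "(\<Sum>i\<le>n. v i) = 1" and "0 \<le> c"
    and g: "\<And>i. i < n \<Longrightarrow> v i \<noteq> 0 \<Longrightarrow> \<bar>u - g i\<bar> \<le> c" "\<bar>u - g n\<bar> \<le> d"
  shows "\<bar>u - (\<Sum>i\<le>n. v i * g i)\<bar> \<le> c + d * v n"
proof -
  have vsum: "(\<Sum>i\<le>n. v i * r) = r" for r
    using v(2) by (metis sum_distrib_right mult_1)
  have "u - (\<Sum>i\<le>n. v i * g i) = (\<Sum>i\<le>n. v i * u) - (\<Sum>i\<le>n. v i * g i)"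
    unfolding vsum ..
  then have "\<bar>u - (\<Sum>i\<le>n. v i * g i)\<bar> = \<bar>\<Sum>i\<le>n. v i * (u - g i)\<bar>"
    by (simp only: sum_subtractf right_diff_distrib)
  also have "\<dots> \<le> (\<Sum>i\<le>n. v i * \<bar>u - g i\<bar>)"
    using v(1) by (intro order_trans[OF sum_abs] sum_mono) (simp add: abs_mult)
  also have "\<dots> = (\<Sum>i<n. v i * \<bar>u - g i\<bar>) + v n * \<bar>u - g n\<bar>"
    by (simp add: lessThan_Suc_atMost[symmetric])
  also have "(\<Sum>i<n. v i * \<bar>u - g i\<bar>) \<le> (\<Sum>i<n. v i * c)"
    using v(1) g(1) by (intro sum_mono) (metis lessThan_iff less_imp_le mult_eq_0_iff mult_left_mono order_refl)
  also have "\<dots> \<le> (\<Sum>i\<le>n. v i * c)"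
    using v(1) \<open>0 \<le> c\<close> by (intro sum_mono2) auto
  also have "\<dots> = c" by (rule vsum)
  also have "v n * \<bar>u - g n\<bar> \<le> d * v n" using mult_left_mono[OF g(2) v(1)[of n]] by (simp add: mult.commute)
  finally show ?thesis by simp
qed

text \<open>Replacing \<open>V\<close> by the representative points costs \<open>e\<close> as long
  as \<open>W\<close> stays in \<open>L\<close> and the remainder index \<open>n\<close> is avoided;
  each exception costs at most \<open>2 * C\<close>. The weights may be indicators of events or
  fractional, so both sides of the later comparison are covered.\<close>

lemma (in prob_space) utility_discretization:
  fixes S :: "'b::euclidean_space set" and T :: "'c::euclidean_space set" and U :: "'b \<times> 'c \<Rightarrow> real"
    and n :: nat
  assumes cont: "continuous_on (S \<times> T) U" and C: "\<And>z. z \<in> S \<times> T \<Longrightarrow> \<bar>U z\<bar> \<le> C"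
    and V: "V \<in> rvs M S" and W: "W \<in> rvs M T"
    and x: "\<And>i. i \<le> n \<Longrightarrow> x i \<in> S" and L: "L \<in> sets borel"
    and v: "\<And>i. i \<le> n \<Longrightarrow> v i \<in> borel_measurable M" "\<And>i \<omega>. i \<le> n \<Longrightarrow> \<omega> \<in> space M \<Longrightarrow> 0 \<le> v i \<omega>"
      "\<And>\<omega>. \<omega> \<in> space M \<Longrightarrow> (\<Sum>i\<le>n. v i \<omega>) = 1" 
    and e: "0 \<le> e" "\<And>i \<omega> y. i < n \<Longrightarrow> \<omega> \<in> space M \<Longrightarrow> v i \<omega> \<noteq> 0 \<Longrightarrow> y \<in> L \<Longrightarrow> y \<in> T \<Longrightarrow>
      \<bar>U (V \<omega>, y) - U (x i, y)\<bar> \<le> e"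
  shows "\<bar>(\<integral>\<omega>. U (V \<omega>, W \<omega>) \<partial>M) - (\<Sum>i\<le>n. \<integral>\<omega>. v i \<omega> * U (x i, W \<omega>) \<partial>M)\<bar>
    \<le> e + 2 * C * measure M {\<omega>\<in>space M. W \<omega> \<notin> L} + 2 * C * (\<integral>\<omega>. v n \<omega> \<partial>M)"
proof -
  have sp: "V \<omega> \<in> S" "W \<omega> \<in> T" if "\<omega> \<in> space M" for \<omega>
    using measurable_space[OF V that] measurable_space[OF W that] by (simp_all add: space_restrict_space)
  have V'[measurable]: "V \<in> borel_measurable M" and W'[measurable]: "W \<in> borel_measurable M"
    using V W by (simp_all add: measurable_restrict_space2_iff)
  have "(\<lambda>\<omega>. (V \<omega>, W \<omega>)) \<in> rvs M (S \<times> T)"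
    using sp by (intro measurable_restrict_space2) auto
  from measurable_compose[OF this borel_measurable_continuous_on_restrict[OF cont]]
  have Um: "(\<lambda>\<omega>. U (V \<omega>, W \<omega>)) \<in> borel_measurable M" .
  have Uxm: "(\<lambda>\<omega>. U (x i, W \<omega>)) \<in> borel_measurable M" if "i \<le> n" for i
  proof -
    have "continuous_on T (\<lambda>y. U (x i, y))"
      using x[OF that] by (intro continuous_on_compose2[OF cont] continuous_intros) auto
    from measurable_compose[OF W borel_measurable_continuous_on_restrict[OF this]] show ?thesis .
  qed
  obtain \<omega>0 where "\<omega>0 \<in> space M" using not_empty by blast
  then have C0: "0 \<le> C" using C[of "(V \<omega>0, W \<omega>0)"] sp by (auto intro: order_trans[OF abs_ge_zero])
  have v1: "v i \<omega> \<le> 1" if "i \<le> n" "\<omega> \<in> space M" for i \<omega>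
    using member_le_sum[of i "{..n}" "\<lambda>i. v i \<omega>"] v that by auto
  have vint: "integrable M (v i)" if "i \<le> n" for i
    using v v1 that by (intro integrable_const_bound[where B = 1]) auto
  have Uint: "integrable M (\<lambda>\<omega>. U (V \<omega>, W \<omega>))"
    using Um C sp by (intro integrable_const_bound[where B = C]) auto
  have vUint: "integrable M (\<lambda>\<omega>. v i \<omega> * U (x i, W \<omega>))" if i: "i \<le> n" for i
  proof (rule integrable_const_bound[where B = C])
    show "AE \<omega> in M. norm (v i \<omega> * U (x i, W \<omega>)) \<le> C"
    proof (rule AE_I2)
      fix \<omega> assume \<omega>: "\<omega> \<in> space M"
      have "\<bar>v i \<omega>\<bar> * \<bar>U (x i, W \<omega>)\<bar> \<le> 1 * C"
        using v v1 i \<omega> C x sp by (intro mult_mono) auto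
      then show "norm (v i \<omega> * U (x i, W \<omega>)) \<le> C" by (simp add: abs_mult)
    qed
  qed (use Uxm v i in auto)
  have sint: "integrable M (\<lambda>\<omega>. \<Sum>i\<le>n. v i \<omega> * U (x i, W \<omega>))"
    by (intro Bochner_Integration.integrable_sum vUint) simp
  define b where "b \<omega> = e + 2 * C * indicator {\<omega>\<in>space M. W \<omega> \<notin> L} \<omega> + 2 * C * v n \<omega>" for \<omega>
  have Ls: "{\<omega>\<in>space M. W \<omega> \<notin> L} \<in> sets M" using L by measurable
  have lint: "integrable M (indicator {\<omega>\<in>space M. W \<omega> \<notin> L} :: _ \<Rightarrow> real)"
    using Ls by (simp add: integrable_real_indicator emeasure_eq_measure)
  have bint: "integrable M b" unfolding b_def using vint lint by auto
  have pt: "\<bar>U (V \<omega>, W \<omega>) - (\<Sum>i\<le>n. v i \<omega> * U (x i, W \<omega>))\<bar> \<le> b \<omega>" if \<omega>: "\<omega> \<in> space M" for \<omega>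
  proof -
    have U2: "\<bar>U (V \<omega>, W \<omega>) - U (x i, W \<omega>)\<bar> \<le> 2 * C" if "i \<le> n" for i
      using C[of "(V \<omega>, W \<omega>)"] C[of "(x i, W \<omega>)"] x[OF that] sp[OF \<omega>] by auto
    have "\<bar>U (V \<omega>, W \<omega>) - U (x i, W \<omega>)\<bar> \<le> e + 2 * C * indicator {\<omega>\<in>space M. W \<omega> \<notin> L} \<omega>"
      if "i < n" "v i \<omega> \<noteq> 0" for i
      using that \<omega> e U2[of i] sp by (cases "W \<omega> \<in> L") auto
    then show ?thesis unfolding b_def
      using v(2)[OF _ \<omega>] \<omega> e(1) C0 U2[of n] v(3)[OF \<omega>]
      by (intro convex_comb_error) (auto simp del: sum.atMost_Suc)
  qed
  have "\<bar>(\<integral>\<omega>. U (V \<omega>, W \<omega>) \<partial>M) - (\<Sum>i\<le>n. \<integral>\<omega>. v i \<omega> * U (x i, W \<omega>) \<partial>M)\<bar>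
      = \<bar>\<integral>\<omega>. U (V \<omega>, W \<omega>) - (\<Sum>i\<le>n. v i \<omega> * U (x i, W \<omega>)) \<partial>M\<bar>"
    unfolding Bochner_Integration.integral_diff[OF Uint sint]
    by (subst Bochner_Integration.integral_sum) (auto intro: vUint)
  also have "\<dots> \<le> (\<integral>\<omega>. \<bar>U (V \<omega>, W \<omega>) - (\<Sum>i\<le>n. v i \<omega> * U (x i, W \<omega>))\<bar> \<partial>M)"
    by (rule integral_abs_bound)
  also have "\<dots> \<le> (\<integral>\<omega>. b \<omega> \<partial>M)"
    using pt by (intro integral_mono integrable_abs Bochner_Integration.integrable_diff Uint sint bint)
  also have "\<dots> = e + 2 * C * measure M {\<omega>\<in>space M. W \<omega> \<notin> L} + 2 * C * (\<integral>\<omega>. v n \<omega> \<partial>M)"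
    unfolding b_def using vint lint Ls by (simp add: prob_space)
  finally show ?thesis .
qed

text \<open>Both expectations are compared with a discretised sum over the cells. The rearrangement
  makes the two sums equal, so only two discretisation errors remain.\<close>

lemma (in prob_space) rearranged_utility_le:
  fixes S :: "'b::euclidean_space set" and T :: "'c::euclidean_space set" and U :: "'b \<times> 'c \<Rightarrow> real"
  assumes na: "nonatomic_measure M" and S: "closed S" and T: "closed T"
    and cont: "continuous_on (S \<times> T) U" and bdd: "bounded (U ` (S \<times> T))"
    and X: "X \<in> rvs M S" and Xs: "\<And>k. Xs k \<in> rvs M S" and Y: "Y \<in> rvs M T"
    and conv: "weakly_converges S (\<lambda>k. law M S (Xs k)) (law M S X)" and "0 < e"
  shows "\<forall>\<^sub>F k in sequentially. \<exists>Y'\<in>rvs M T. law M T Y' = law M T Y \<and>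
    (\<integral>\<omega>. U (Xs k \<omega>, Y' \<omega>) \<partial>M) \<le> (\<integral>\<omega>. U (X \<omega>, Y \<omega>) \<partial>M) + e"
proof -
  have sp: "V \<omega> \<in> S" if "V \<in> rvs M S" "\<omega> \<in> space M" for V \<omega>
    using measurable_space[OF that] by (simp add: space_restrict_space)
  have mX: "V \<in> borel_measurable M" if "V \<in> rvs M S" for V
    using that by (simp add: measurable_restrict_space2_iff)
  have mY: "W \<in> borel_measurable M" if "W \<in> rvs M T" for W
    using that by (simp add: measurable_restrict_space2_iff)
  obtain C where C: "0 < C" "\<And>z. z \<in> S \<times> T \<Longrightarrow> \<bar>U z\<bar> \<le> C"
    using bdd unfolding bounded_pos by auto
  \<comment> \<open>Each discretisation will cost at most
    \<open>\<epsilon> + 2 * C * \<epsilon> + 2 * C * (3 * \<epsilon>)\<close>, and there are two of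
    them. The bound 1/2 keeps the factor \<open>a\<close> below positive.\<close>
  define \<epsilon> where "\<epsilon> = min (1 / 2) (e / (2 + 16 * C))"
  have e: "0 < \<epsilon>" "\<epsilon> < 1" "\<epsilon> * (2 + 16 * C) \<le> e"
  proof -
    have "\<epsilon> \<le> e / (2 + 16 * C)" by (simp add: \<epsilon>_def)
    then show "\<epsilon> * (2 + 16 * C) \<le> e" using C(1) by (simp add: pos_le_divide_eq)
  qed (use C(1) \<open>0 < e\<close> in \<open>auto simp: \<epsilon>_def\<close>)
  define \<mu> where "\<mu> = distr M borel X"
  interpret \<mu>: prob_space \<mu> unfolding \<mu>_def using mX[OF X] by (rule prob_space_distr)
  have \<mu>: "measure \<mu> B = measure M {\<omega>\<in>space M. X \<omega> \<in> B}" if "B \<in> sets borel" for B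
    unfolding \<mu>_def using that mX[OF X]
    by (subst measure_distr) (auto intro!: arg_cong[where f = "measure M"])
  define \<nu> where "\<nu> = distr M borel Y"
  interpret \<nu>: prob_space \<nu> unfolding \<nu>_def using mY[OF Y] by (rule prob_space_distr)
  have \<nu>: "measure \<nu> B = measure M {\<omega>\<in>space M. Y \<omega> \<in> B}" if "B \<in> sets borel" for B
    unfolding \<nu>_def using that mY[OF Y]
    by (subst measure_distr) (auto intro!: arg_cong[where f = "measure M"])
  obtain S0 where S0: "compact S0" "S0 \<subseteq> S" "measure \<mu> S - \<epsilon> < measure \<mu> S0"
    using inner_regular_measure[OF \<mu>.finite_measure_axioms, of S \<epsilon>] S e by (auto simp: \<mu>_def)
  have "measure \<mu> S = 1"
    unfolding \<mu>[OF borel_closed[OF S]] using sp[OF X] prob_space by (simp cong: conj_cong)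
  then have S0m: "1 - \<epsilon> < measure \<mu> S0" using S0 by simp
  obtain L where L: "compact L" "L \<subseteq> UNIV" "measure \<nu> UNIV - \<epsilon> < measure \<nu> L"
    using inner_regular_measure[OF \<nu>.finite_measure_axioms, of UNIV \<epsilon>] e by (auto simp: \<nu>_def)
  have Ls: "L \<in> sets borel" using L by (simp add: borel_closed compact_imp_closed)
  have "measure M {\<omega>\<in>space M. Y \<omega> \<in> UNIV} = 1" using prob_space by simp
  then have Lm: "1 - \<epsilon> < measure M {\<omega>\<in>space M. Y \<omega> \<in> L}"
    using L(3) by (simp add: \<nu> Ls)
  obtain R where R: "S0 \<subseteq> ball 0 R" using bounded_subset_ballD[OF compact_imp_bounded[OF S0(1)]] by blast
  \<comment> \<open>The values of \<open>Xs k\<close> need not lie in \<open>S0\<close>; the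
    enlarged ball leaves room for points near the cells while \<open>S1\<close> remains
    compact.\<close>
  define S1 where "S1 = S \<inter> cball 0 (R + 1)"
  have "compact (S1 \<times> (L \<inter> T))"
    unfolding S1_def using S T L(1) by (intro compact_Times closed_Int_compact compact_Int_closed) auto
  then have "uniformly_continuous_on (S1 \<times> (L \<inter> T)) U"
    by (intro compact_uniformly_continuous continuous_on_subset[OF cont]) (auto simp: S1_def)
  then obtain d where d: "0 < d" "\<And>p q. p \<in> S1 \<times> (L \<inter> T) \<Longrightarrow> q \<in> S1 \<times> (L \<inter> T) \<Longrightarrow> dist q p < d \<Longrightarrow> dist (U q) (U p) < \<epsilon>"
    unfolding uniformly_continuous_on_def using e(1) by metis
  \<comment> \<open>A point of a neighbourhood is within \<open>2 * \<delta>\<close> of the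
    representative of its cell: at most 1, so it lies in \<open>S1\<close>, and at most
    \<open>d\<close>, so uniform continuity applies.\<close>
  define \<delta> where "\<delta> = min 1 d / 2"
  have \<delta>: "0 < \<delta>" "2 * \<delta> \<le> 1" "2 * \<delta> \<le> d" using d(1) by (auto simp: \<delta>_def)
  obtain n :: nat and K where K: "\<And>i. i < n \<Longrightarrow> compact (K i)" "\<And>i. i < n \<Longrightarrow> K i \<subseteq> S0"
      "disjoint_family_on K {..<n}" "\<And>i x y. i < n \<Longrightarrow> x \<in> K i \<Longrightarrow> y \<in> K i \<Longrightarrow> dist x y < \<delta>"
      "measure \<mu> S0 - \<epsilon> \<le> (\<Sum>i<n. measure \<mu> (K i))"
    using compact_cells[OF \<mu>.finite_measure_axioms _ S0(1) \<delta>(1) e(1)] unfolding \<mu>_def sets_distr by metis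
  have Ks: "K i \<in> sets borel" if "i < n" for i using K(1)[OF that] by (simp add: borel_closed compact_imp_closed)
  obtain r where r: "0 < r" "r \<le> \<delta>" "disjoint_family_on (\<lambda>i. \<Union>a\<in>K i. ball a r) {..<n}"
    using disjoint_compacts_separated[OF K(1,3) \<delta>(1)] by blast
  define G where "G i = (\<Union>a\<in>K i. ball a r)" for i
  have KG: "K i \<subseteq> G i" for i using r(1) by (auto simp: G_def)
  have Gs: "open (G i)" for i by (auto simp: G_def)
  obtain \<omega>0 where \<omega>0: "\<omega>0 \<in> space M" using not_empty by blast
  \<comment> \<open>The default value serves empty cells and the remainder index \<open>n\<close>;
    it keeps every \<open>x i\<close> in \<open>S\<close>.\<close>
  define x where "x i = (if i < n \<and> K i \<noteq> {} then SOME a. a \<in> K i else X \<omega>0)" for i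
  have xK: "x i \<in> K i" if "i < n" "K i \<noteq> {}" for i
    using that by (simp add: x_def some_in_eq)
  have xS: "x i \<in> S" for i
    using xK[of i] K(2)[of i] S0(2) sp[OF X \<omega>0] by (cases "i < n \<and> K i \<noteq> {}") (auto simp: x_def)
  have close: "\<bar>U (z, y) - U (x i, y)\<bar> \<le> \<epsilon>" if i: "i < n" "z \<in> G i" and z: "z \<in> S" "y \<in> L" "y \<in> T" for i z y
  proof -
    obtain a where a: "a \<in> K i" "dist a z < r" using i(2) by (auto simp: G_def)
    then have xi: "x i \<in> K i" using xK i(1) by blast
    then have "dist (x i) a < \<delta>" using K(4) i(1) a by blast
    then have dz: "dist (x i) z < 2 * \<delta>" using dist_triangle[of "x i" z a] a(2) r(2) by simp
    have "norm (x i) < R" using xi K(2)[OF i(1)] R by (auto simp: subset_iff)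
    then have "x i \<in> S1" "z \<in> S1"
      using xS z(1) dz \<delta>(2) norm_triangle_sub[of z "x i"] by (auto simp: S1_def dist_norm norm_minus_commute)
    moreover have "dist (z, y) (x i, y) < d" using dz \<delta>(3) by (simp add: dist_Pair_Pair dist_commute)
    ultimately have "dist (U (z, y)) (U (x i, y)) < \<epsilon>" using z by (intro d(2)) auto
    then show ?thesis by (simp add: dist_real_def)
  qed
  define m where "m i = measure M {\<omega>\<in>space M. X \<omega> \<in> K i}" for i
  have m0: "0 \<le> m i" for i by (simp add: m_def)
  \<comment> \<open>Weak convergence secures only masses strictly below \<open>m i\<close> in the
    neighbourhoods, so \<open>a * m i\<close> is what each cell transports.\<close>
  define a where "a = 1 - \<epsilon>"
  have a: "0 < a" "a < 1" using e by (auto simp: a_def)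
  have "(\<Sum>i<n. measure \<mu> (K i)) = (\<Sum>i<n. m i)" using \<mu> Ks by (simp add: m_def)
  then have "1 - 2 * \<epsilon> \<le> (\<Sum>i<n. m i)" using K(5) S0m by simp
  then have "(1 - \<epsilon>) * (1 - 2 * \<epsilon>) \<le> a * (\<Sum>i<n. m i)" using a by (simp add: a_def)
  moreover have "1 - 3 * \<epsilon> \<le> (1 - \<epsilon>) * (1 - 2 * \<epsilon>)" by (simp add: algebra_simps)
  \<comment> \<open>The mass not transported has three sources, each at most \<epsilon>: the
    restriction to \<open>S0\<close>, the passage to compact cells, and the factor
    \<open>a\<close>.\<close>
  ultimately have am: "1 - (\<Sum>i<n. a * m i) \<le> 3 * \<epsilon>" by (simp add: sum_distrib_left)
  have "\<forall>\<^sub>F k in sequentially. a * m i \<le> measure M {\<omega>\<in>space M. Xs k \<omega> \<in> G i}" if i: "i < n" for i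
  \<comment> \<open>For a null cell \<open>a * m i < m i\<close> fails, but the required bound is
    trivial.\<close>
  proof (cases "m i = 0")
    case False
    then have "a * m i < measure M {\<omega>\<in>space M. X \<omega> \<in> K i}"
      using a m0[of i] by (simp flip: m_def)
    from weakly_converges_open_lower[OF X Xs conv compact_imp_closed[OF K(1)[OF i]] Gs KG this]
    show ?thesis by eventually_elim simp
  qed simp
  then have "\<forall>\<^sub>F k in sequentially. \<forall>i\<in>{..<n}. a * m i \<le> measure M {\<omega>\<in>space M. Xs k \<omega> \<in> G i}"
    by (intro eventually_ball_finite) auto
  then show ?thesis
  proof eventually_elim
    fix k assume k: "\<forall>i\<in>{..<n}. a * m i \<le> measure M {\<omega>\<in>space M. Xs k \<omega> \<in> G i}"
    have "\<exists>E. E \<in> sets M \<and> E \<subseteq> {\<omega>\<in>space M. Xs k \<omega> \<in> G i} \<and> measure M E = a * m i" if i: "i < n" for i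
    proof -
      have "{\<omega>\<in>space M. Xs k \<omega> \<in> G i} \<in> sets M"
        using mX[OF Xs, of k] borel_open[OF Gs[of i]] by measurable
      then obtain E where "E \<in> sets M" "{} \<subseteq> E" "E \<subseteq> {\<omega>\<in>space M. Xs k \<omega> \<in> G i}" "measure M E = a * m i"
        using nonatomic_intermediate_value[OF na, of "{}" _ "a * m i"] k i a m0[of i] by auto
      then show ?thesis by blast
    qed
    then obtain E where E: "\<And>i. i < n \<Longrightarrow> E i \<in> sets M" "\<And>i. i < n \<Longrightarrow> E i \<subseteq> {\<omega>\<in>space M. Xs k \<omega> \<in> G i}"
        "\<And>i. i < n \<Longrightarrow> measure M (E i) = a * m i" by metis
    have disjE: "disjoint_family_on E {..<n}"
      unfolding disjoint_family_on_def
    proof (intro ballI impI)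
      fix i j assume ij: "i \<in> {..<n}" "j \<in> {..<n}" "i \<noteq> j"
      then have "G i \<inter> G j = {}" using disjoint_family_onD[OF r(3)] unfolding G_def by metis
      then show "E i \<inter> E j = {}" using E(2)[of i] E(2)[of j] ij by fastforce
    qed
    define E' where "E' i = (if i < n then E i else space M - (\<Union>j<n. E j))" for i
    define w where "w i \<omega> = (if i < n then a * indicator (K i) (X \<omega>) else 1 - (\<Sum>j<n. a * indicator (K j) (X \<omega>)))" for i \<omega>
    have E's: "E' i \<in> sets M" for i unfolding E'_def using E(1) by auto
    \<comment> \<open>Disjointness of the cells bounds the sum of their indicators by 1, so the
      remainder weight is nonnegative.\<close>
    have wn: "w n \<omega> = 1 - a * indicator (\<Union>j<n. K j) (X \<omega>)" for \<omega>
    proof -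
      have "(\<Sum>j<n. indicator (K j) (X \<omega>)) = (indicator (\<Union>j<n. K j) (X \<omega>) :: real)"
        by (rule indicator_UN_disjoint[OF finite_lessThan K(3), symmetric])
      then show ?thesis unfolding w_def sum_distrib_left[symmetric] by (simp only: less_irrefl if_False)
    qed
    have wm: "w i \<in> borel_measurable M" for i
    proof -
      have ind: "(\<lambda>\<omega>. indicator (K j) (X \<omega>) :: real) \<in> borel_measurable M" if "j \<in> {..<n}" for j
        using measurable_compose[OF mX[OF X] borel_measurable_indicator[OF Ks[of j]]] that by simp
      show ?thesis
      proof (cases "i < n")
        case True
        then have "w i = (\<lambda>\<omega>. a * indicator (K i) (X \<omega>))" by (simp add: w_def fun_eq_iff)
        then show ?thesis using ind[of i] True by simp
      next
        case False
        then have "w i = (\<lambda>\<omega>. 1 - (\<Sum>j<n. a * indicator (K j) (X \<omega>)))" by (intro ext) (simp only: w_def if_False)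
        then show ?thesis
          by (simp only:) (intro borel_measurable_diff borel_measurable_const borel_measurable_sum borel_measurable_times ind)
      qed
    qed
    have w0: "0 \<le> w i \<omega>" if "i \<le> n" for i \<omega>
    proof (cases "i < n")
      case True then show ?thesis using a by (simp add: w_def)
    next
      case False
      then have "i = n" using that by simp
      then show ?thesis using a wn[of \<omega>] by (simp add: indicator_def)
    qed
    have w1: "(\<Sum>i\<le>n. w i \<omega>) = 1" for \<omega>
      unfolding lessThan_Suc_atMost[symmetric] by (simp add: w_def)
    have disjE': "disjoint_family_on E' {..<Suc n}"
      using disjE unfolding disjoint_family_on_def E'_def by (auto simp: less_Suc_eq)
    have UE': "(\<Union>i<Suc n. E' i) = space M"
      using E(1) sets.sets_into_space by (fastforce simp: E'_def less_Suc_eq)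
    have wint: "(\<integral>\<omega>. w i \<omega> \<partial>M) = a * m i" if i: "i < n" for i
    proof -
      have "{\<omega>\<in>space M. X \<omega> \<in> K i} \<in> sets M" using mX[OF X] Ks[OF i] by measurable
      moreover have "(\<integral>\<omega>. indicator (K i) (X \<omega>) \<partial>M) = (\<integral>\<omega>. indicator {\<omega>\<in>space M. X \<omega> \<in> K i} \<omega> \<partial>M :: real)"
        by (intro Bochner_Integration.integral_cong) (auto simp: indicator_def)
      ultimately show ?thesis using i by (simp add: w_def m_def)
    qed
    have wb: "w i \<omega> \<le> 1" if "i \<le> n" for i \<omega>
      using member_le_sum[of i "{..n}" "\<lambda>i. w i \<omega>"] w0 w1[of \<omega>] that by auto
    have wi: "integrable M (w i)" if "i \<le> n" for i
      using w0 wb wm that by (intro integrable_const_bound[where B = 1]) auto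
    have "1 = (\<integral>\<omega>. (\<Sum>i\<le>n. w i \<omega>) \<partial>M)" using prob_space by (simp add: w1)
    also have "\<dots> = (\<Sum>i\<le>n. \<integral>\<omega>. w i \<omega> \<partial>M)" using wi by (intro Bochner_Integration.integral_sum) auto
    finally have wnint: "(\<integral>\<omega>. w n \<omega> \<partial>M) = 1 - (\<Sum>i<n. a * m i)"
      using wint by (simp add: lessThan_Suc_atMost[symmetric])
    have "measure M (\<Union>j<n. E j) = (\<Sum>i<n. a * m i)"
      using E disjE by (subst finite_measure_finite_Union) auto
    then have "measure M (E' n) = 1 - (\<Sum>i<n. a * m i)"
      using E(1) by (simp add: E'_def prob_compl)
    then have Ew: "measure M (E' i) = (\<integral>\<omega>. w i \<omega> \<partial>M)" if "i < Suc n" for i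
      using that E(3) wint wnint by (cases "i < n") (auto simp: E'_def less_Suc_eq)
    have w1': "(\<Sum>i<Suc n. w i \<omega>) = 1" for \<omega>
      using w1[of \<omega>] by (simp only: lessThan_Suc_atMost)
    have wp: "0 \<le> w i \<omega>" if "i < Suc n" for i \<omega>
      using w0[of i] that by simp
    obtain Y' where Y': "Y' \<in> rvs M T" "law M T Y' = law M T Y"
      "\<forall>i<Suc n. \<forall>f\<in>borel_measurable (borel_on T).
        (\<integral>\<omega>. indicator (E' i) \<omega> * f (Y' \<omega>) \<partial>M) = (\<integral>\<omega>. w i \<omega> * f (Y \<omega>) \<partial>M :: real)"
      by (rule nonatomic_rearrange[OF na borel_closed[OF T] Y E's disjE' UE' wm wp w1' Ew])
    \<comment> \<open>The rearrangement identity is tested with the function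
      \<open>U (x i, y)\<close> of \<open>y\<close>, for every \<open>i\<close> including the
      remainder.\<close>
    have mid: "(\<Sum>i\<le>n. \<integral>\<omega>. indicator (E' i) \<omega> * U (x i, Y' \<omega>) \<partial>M) = (\<Sum>i\<le>n. \<integral>\<omega>. w i \<omega> * U (x i, Y \<omega>) \<partial>M)"
    proof (rule sum.cong)
      fix i assume "i \<in> {..n}"
      moreover have "continuous_on T (\<lambda>y. U (x i, y))"
        using xS by (intro continuous_on_compose2[OF cont] continuous_intros) auto
      ultimately show "(\<integral>\<omega>. indicator (E' i) \<omega> * U (x i, Y' \<omega>) \<partial>M) = (\<integral>\<omega>. w i \<omega> * U (x i, Y \<omega>) \<partial>M)"
        by (intro Y'(3)[rule_format] borel_measurable_continuous_on_restrict) auto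
    qed simp
    have indE1: "(\<Sum>i\<le>n. indicator (E' i) \<omega>) = (1::real)" if "\<omega> \<in> space M" for \<omega>
    proof -
      have "(\<Sum>i<Suc n. indicator (E' i) \<omega>) = (indicator (\<Union>i<Suc n. E' i) \<omega> :: real)"
        by (rule indicator_UN_disjoint[OF finite_lessThan disjE', symmetric])
      then show ?thesis using that by (simp only: UE' indicator_simps flip: lessThan_Suc_atMost)
    qed
    have d1: "\<bar>(\<integral>\<omega>. U (Xs k \<omega>, Y' \<omega>) \<partial>M) - (\<Sum>i\<le>n. \<integral>\<omega>. indicator (E' i) \<omega> * U (x i, Y' \<omega>) \<partial>M)\<bar>
        \<le> \<epsilon> + 2 * C * measure M {\<omega>\<in>space M. Y' \<omega> \<notin> L} + 2 * C * (\<integral>\<omega>. indicator (E' n) \<omega> \<partial>M)"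
    proof (rule utility_discretization[OF cont C(2) Xs Y'(1) xS Ls _ _ indE1])
      show "\<bar>U (Xs k \<omega>, y) - U (x i, y)\<bar> \<le> \<epsilon>"
        if "i < n" "\<omega> \<in> space M" "indicator (E' i) \<omega> \<noteq> (0::real)" "y \<in> L" "y \<in> T" for i \<omega> y
        using that E(2)[of i] sp[OF Xs] by (intro close) (auto simp: E'_def indicator_def split: if_splits)
    qed (use E's e in auto)
    have d2: "\<bar>(\<integral>\<omega>. U (X \<omega>, Y \<omega>) \<partial>M) - (\<Sum>i\<le>n. \<integral>\<omega>. w i \<omega> * U (x i, Y \<omega>) \<partial>M)\<bar>
        \<le> \<epsilon> + 2 * C * measure M {\<omega>\<in>space M. Y \<omega> \<notin> L} + 2 * C * (\<integral>\<omega>. w n \<omega> \<partial>M)"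
    proof (rule utility_discretization[OF cont C(2) X Y xS Ls wm w0 w1])
      show "\<bar>U (X \<omega>, y) - U (x i, y)\<bar> \<le> \<epsilon>"
        if "i < n" "\<omega> \<in> space M" "w i \<omega> \<noteq> 0" "y \<in> L" "y \<in> T" for i \<omega> y
        using that KG[of i] sp[OF X] by (intro close) (auto simp: w_def indicator_def split: if_splits)
    qed (use e in auto)
    \<comment> \<open>\<open>L\<close> was chosen for \<open>Y\<close>; equality of laws carries its
      bound over to \<open>Y'\<close>.\<close>
    have YL: "measure M {\<omega>\<in>space M. W \<omega> \<notin> L} \<le> \<epsilon>" if W: "W \<in> rvs M T" "law M T W = law M T Y" for W
    proof -
      have LT: "L \<inter> T \<in> sets (borel_on T)" using Ls by (auto simp: sets_restrict_space)
      have eq: "measure (law M T V) (L \<inter> T) = measure M {\<omega>\<in>space M. V \<omega> \<in> L}" if "V \<in> rvs M T" for V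
        using measurable_space[OF that] LT that
        by (subst measure_distr) (auto simp: space_restrict_space intro!: arg_cong[where f = "measure M"])
      have "{\<omega>\<in>space M. W \<omega> \<in> L} \<in> sets M" using mY[OF W(1)] Ls by measurable
      then have "measure M {\<omega>\<in>space M. W \<omega> \<notin> L} = 1 - measure M {\<omega>\<in>space M. W \<omega> \<in> L}"
        by (subst prob_neg) auto
      also have "measure M {\<omega>\<in>space M. W \<omega> \<in> L} = measure M {\<omega>\<in>space M. Y \<omega> \<in> L}"
        using eq[OF W(1)] eq[OF Y] W(2) by simp
      finally show ?thesis using Lm by simp
    qed
    have "(\<integral>\<omega>. w n \<omega> \<partial>M) \<le> 3 * \<epsilon>" using wnint am by simp
    moreover have "(\<integral>\<omega>. indicator (E' n) \<omega> \<partial>M) = (\<integral>\<omega>. w n \<omega> \<partial>M)"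
      using Ew[of n] E's[of n] by simp
    ultimately have wE: "2 * C * (\<integral>\<omega>. w n \<omega> \<partial>M) \<le> 2 * C * (3 * \<epsilon>)" 
        "2 * C * (\<integral>\<omega>. indicator (E' n) \<omega> \<partial>M) \<le> 2 * C * (3 * \<epsilon>)"
      using C(1) by (intro mult_left_mono; simp)+
    have YE: "2 * C * measure M {\<omega>\<in>space M. Y' \<omega> \<notin> L} \<le> 2 * C * \<epsilon>"
         "2 * C * measure M {\<omega>\<in>space M. Y \<omega> \<notin> L} \<le> 2 * C * \<epsilon>"
      using C(1) YL Y' Y by (intro mult_left_mono; simp)+
    have arith: "p - q \<le> 2 * (\<epsilon> + b + c)"
      if "p - s \<le> \<epsilon> + y + z" "- (q - s) \<le> \<epsilon> + y' + z'" "y \<le> b" "y' \<le> b" "z \<le> c" "z' \<le> c"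
      for p q s b c y z y' z' :: real
      using that by argo
    have "(\<integral>\<omega>. U (Xs k \<omega>, Y' \<omega>) \<partial>M) - (\<integral>\<omega>. U (X \<omega>, Y \<omega>) \<partial>M) \<le> 2 * (\<epsilon> + 2 * C * \<epsilon> + 2 * C * (3 * \<epsilon>))"
      by (rule arith[OF abs_le_D1[OF d1[unfolded mid]] abs_le_D2[OF d2] YE wE(2,1)])
    also have "\<dots> = \<epsilon> * (2 + 16 * C)" by (simp add: algebra_simps)
    finally show "\<exists>Y'\<in>rvs M T. law M T Y' = law M T Y \<and>
        (\<integral>\<omega>. U (Xs k \<omega>, Y' \<omega>) \<partial>M) \<le> (\<integral>\<omega>. U (X \<omega>, Y \<omega>) \<partial>M) + e"
      using Y' e(3) by (intro bexI[of _ Y']) auto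
  qed
qed

section \<open>Existence of an optimal decision\<close>

theorem theorem3p1:
  fixes M :: "'w measure"
    and XX :: "(real ^ 'n) set" and YY :: "(real ^ 'm) set"
    and U :: "(real ^ 'n) \<times> (real ^ 'm) \<Rightarrow> real"
    and A :: "('w \<Rightarrow> real ^ 'n) set"
    and \<phi> :: "real \<Rightarrow> ennreal" and \<nu>0 :: "(real ^ 'm) measure" and \<eta> :: real
  assumes "prob_space M" and "complete_measure M" and "nonatomic_measure M"
    and "closed XX" and "convex XX" and "closed YY" and "convex YY"
    and "entropy_function \<phi>" and "\<nu>0 \<in> borel_probs YY"
    and "continuous_on (XX \<times> YY) U" and "bounded (U ` (XX \<times> YY))"
    and "A \<subseteq> rvs M XX" and "A \<noteq> {}"
    and "convex_rvs M A"
    and "weakly_compact XX (laws_of M XX A)"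
    and "\<eta> \<ge> 0"
  shows "\<exists>Xopt\<in>A. worst_case_utility M YY U (ambiguity_set \<phi> YY \<nu>0 \<eta>) Xopt
                 = robust_value M YY U (ambiguity_set \<phi> YY \<nu>0 \<eta>) A"
proof -
  interpret prob_space M by fact
  define D where "D = ambiguity_set \<phi> YY \<nu>0 \<eta>"
  define v where "v = worst_case_utility M YY U D"
  have J: "robust_value M YY U D A = Sup (v ` A)" by (simp add: robust_value_def v_def)
  obtain f :: "nat \<Rightarrow> ereal" where f: "incseq f" "range f \<subseteq> v ` A" "Sup (v ` A) = (SUP i. f i)"
    using Sup_countable_SUP[of "v ` A"] \<open>A \<noteq> {}\<close> by auto
  then have lim: "f \<longlonglongrightarrow> Sup (v ` A)" by (simp add: LIMSEQ_SUP)
  have "\<forall>k. \<exists>Z\<in>A. f k = v Z" using f(2) by blast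
  then obtain Z where Z: "\<And>k. Z k \<in> A" "\<And>k. f k = v (Z k)" by metis
  have rv: "X \<in> rvs M XX" if "X \<in> A" for X using that \<open>A \<subseteq> rvs M XX\<close> by blast
  have "law M XX (Z k) \<in> laws_of M XX A" for k
    using Z(1) rv by (auto simp: laws_of_def borel_probs_def intro!: prob_space_distr)
  then obtain \<mu> r where r: "\<mu> \<in> laws_of M XX A" "strict_mono r" "weakly_converges XX ((\<lambda>k. law M XX (Z k)) \<circ> r) \<mu>"
    using \<open>weakly_compact XX (laws_of M XX A)\<close>[unfolded weakly_compact_def, rule_format, of "\<lambda>k. law M XX (Z k)"]
    by metis
  then obtain X where X: "X \<in> A" "weakly_converges XX (\<lambda>k. law M XX (Z (r k))) (law M XX X)"
    by (auto simp: laws_of_def comp_def)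
  \<comment> \<open>It suffices to bound the supremum by the utility of \<open>X\<close> against
    each feasible \<open>Y\<close>, up to every positive \<open>e\<close>. If no \<open>Y\<close> is
    feasible, \<open>v X\<close> is \<infinity> and the bound is immediate.\<close>
  have "Sup (v ` A) \<le> v X"
    unfolding v_def worst_case_utility_def[of M YY U D X]
  proof (rule INF_greatest, unfold v_def[symmetric])
    fix Y assume "Y \<in> {Y \<in> rvs M YY. law M YY Y \<in> D}"
    then have Y: "Y \<in> rvs M YY" "law M YY Y \<in> D" by auto
    show "Sup (v ` A) \<le> ereal (\<integral>\<omega>. U (X \<omega>, Y \<omega>) \<partial>M)"
    proof (rule ereal_le_epsilon2)
      fix e :: real assume "0 < e"
      have "\<forall>\<^sub>F k in sequentially. \<exists>Y'\<in>rvs M YY. law M YY Y' = law M YY Y \<and>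
          (\<integral>\<omega>. U (Z (r k) \<omega>, Y' \<omega>) \<partial>M) \<le> (\<integral>\<omega>. U (X \<omega>, Y \<omega>) \<partial>M) + e"
        using rearranged_utility_le[of XX YY U X "\<lambda>k. Z (r k)" Y e] assms rv X Z(1) Y(1) \<open>0 < e\<close> by blast
      then have "\<forall>\<^sub>F k in sequentially. (f \<circ> r) k \<le> ereal (\<integral>\<omega>. U (X \<omega>, Y \<omega>) \<partial>M) + ereal e"
      proof eventually_elim
        fix k assume "\<exists>Y'\<in>rvs M YY. law M YY Y' = law M YY Y \<and>
          (\<integral>\<omega>. U (Z (r k) \<omega>, Y' \<omega>) \<partial>M) \<le> (\<integral>\<omega>. U (X \<omega>, Y \<omega>) \<partial>M) + e"
        then obtain Y' where Y': "Y' \<in> rvs M YY" "law M YY Y' = law M YY Y"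
          "(\<integral>\<omega>. U (Z (r k) \<omega>, Y' \<omega>) \<partial>M) \<le> (\<integral>\<omega>. U (X \<omega>, Y \<omega>) \<partial>M) + e" by blast
        \<comment> \<open>\<open>Y'\<close> has the law of \<open>Y\<close>, which belongs to
          \<open>D\<close>, so \<open>Y'\<close> is admissible in the infimum for
          \<open>Z (r k)\<close>.\<close>
        then have "v (Z (r k)) \<le> ereal (\<integral>\<omega>. U (Z (r k) \<omega>, Y' \<omega>) \<partial>M)"
          using Y(2) unfolding v_def worst_case_utility_def by (intro INF_lower) auto
        also have "\<dots> \<le> ereal (\<integral>\<omega>. U (X \<omega>, Y \<omega>) \<partial>M) + ereal e" using Y'(3) by simp
        finally show "(f \<circ> r) k \<le> ereal (\<integral>\<omega>. U (X \<omega>, Y \<omega>) \<partial>M) + ereal e" by (simp add: Z(2))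
      qed
      with LIMSEQ_subseq_LIMSEQ[OF lim r(2)]
      show "Sup (v ` A) \<le> ereal (\<integral>\<omega>. U (X \<omega>, Y \<omega>) \<partial>M) + ereal e"
        by (rule tendsto_upperbound) simp
    qed
  qed
  moreover have "v X \<le> Sup (v ` A)" using X(1) by (intro Sup_upper) simp
  ultimately have "v X = robust_value M YY U D A" unfolding J by (rule antisym[rotated])
  then show ?thesis using X(1) unfolding v_def D_def by blast
qed

end
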